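(* The $r\times r$ minors of an $n\times n$ symmetric matrix of indeterminates do not form a tropical basis when $4<r<n$, or when $r=4$ and $n>12$.
   Context: Let $\tilde K$ be the field of Hahn series $\sum_{\alpha\in A}c_\alpha t^\alpha$ ($A\subset\mathbb R$ well-ordered, $c_\alpha\in\mathbb C$); for nonzero $a\in\tilde K$, $\deg(a)$ is the smallest exponent with nonzero coefficient. A symmetric lift of a real symmetric matrix $A$ is a symmetric matrix $\tilde A$ over $\tilde K$ with all entries nonzero and $\deg(\tilde a_{i,j})=A_{i,j}$. For an $r\times r$ submatrix of $A$ with row index set $I$ and column index set $J$, each bijection $\rho:I\to J$ gives a monomial $\prod_{i\in I}X_{i,\rho(i)}$ in commuting variables subject to $X_{i,j}=X_{j,i}$, with value $\sum_{i\in I}A_{i,\rho(i)}$; the submatrix is symmetrically tropically singular if the minimum value is attained by at least two distinct monomials. The $r\times r$ minors of an $n\times n$ symmetric matrix of indeterminates form a tropical basis if for every real symmetric $n\times n$ matrix $A$: every $r\times r$ submatrix of $A$ is symmetrically tropically singular if and only if $A$ has a symmetric lift of rank at most $r-1$ (equivalently, the tropical prevariety of the tropicalized minors equals the tropicalization of the variety they define). *)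

theory Defs
  imports Complex_Main "HOL-Library.FuncSet" "HOL-Library.Multiset" "HOL-Combinatorics.Permutations"
begin

text \<open>A Hahn series sum c_alpha t^alpha is represented by its coefficient function
  real => complex; it is a Hahn series iff its support is well-ordered.\<close>

definition hahn_support :: "(real \<Rightarrow> complex) \<Rightarrow> real set" where
  "hahn_support f = {a. f a \<noteq> 0}"

definition well_ordered_real :: "real set \<Rightarrow> bool" where
  "well_ordered_real S \<longleftrightarrow> (\<forall>B \<subseteq> S. B \<noteq> {} \<longrightarrow> (\<exists>m\<in>B. \<forall>b\<in>B. m \<le> b))"

definition is_hahn :: "(real \<Rightarrow> complex) \<Rightarrow> bool" where
  "is_hahn f \<longleftrightarrow> well_ordered_real (hahn_support f)"

definition hahn_deg :: "(real \<Rightarrow> complex) \<Rightarrow> real" where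
  "hahn_deg f = (LEAST a. f a \<noteq> 0)"

text \<open>Product of a finite family of Hahn series (Cauchy product): the coefficient of t^g
  is the sum over all choices of exponents a_i in the supports with sum g
  (a finite sum for well-ordered supports).\<close>
definition hahn_prod :: "'i set \<Rightarrow> ('i \<Rightarrow> real \<Rightarrow> complex) \<Rightarrow> real \<Rightarrow> complex" where
  "hahn_prod I f g =
     (\<Sum>a \<in> {a \<in> PiE I (\<lambda>i. hahn_support (f i)). (\<Sum>i\<in>I. a i) = g}. \<Prod>i\<in>I. f i (a i))"

definition hahn_minor :: "(nat \<Rightarrow> nat \<Rightarrow> real \<Rightarrow> complex) \<Rightarrow> nat \<Rightarrow> (nat \<Rightarrow> nat) \<Rightarrow> (nat \<Rightarrow> nat)
    \<Rightarrow> real \<Rightarrow> complex" where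
  "hahn_minor M r u v g =
     (\<Sum>p | p permutes {..<r}. of_int (sign p) * hahn_prod {..<r} (\<lambda>k. M (u k) (v (p k))) g)"

definition hahn_rank_lt :: "nat \<Rightarrow> (nat \<Rightarrow> nat \<Rightarrow> real \<Rightarrow> complex) \<Rightarrow> nat \<Rightarrow> bool" where
  "hahn_rank_lt n M r \<longleftrightarrow>
     (\<forall>u v. (\<forall>k<r. u k < n \<and> v k < n) \<longrightarrow> (\<forall>g. hahn_minor M r u v g = 0))"

definition sym_real_mat :: "nat \<Rightarrow> (nat \<Rightarrow> nat \<Rightarrow> real) \<Rightarrow> bool" where
  "sym_real_mat n A \<longleftrightarrow> (\<forall>i<n. \<forall>j<n. A i j = A j i)"

definition symmetric_lift :: "nat \<Rightarrow> (nat \<Rightarrow> nat \<Rightarrow> real) \<Rightarrow> (nat \<Rightarrow> nat \<Rightarrow> real \<Rightarrow> complex) \<Rightarrow> bool" where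
  "symmetric_lift n A M \<longleftrightarrow>
     (\<forall>i<n. \<forall>j<n. is_hahn (M i j) \<and> M i j \<noteq> (\<lambda>_. 0) \<and> hahn_deg (M i j) = A i j \<and> M i j = M j i)"

text \<open>The monomial prod_{i in I} X_{i, rho i} in commuting variables with X_{i,j} = X_{j,i},
  represented as a multiset of unordered index pairs (normalised as (min, max)).\<close>
definition sym_monomial :: "nat set \<Rightarrow> (nat \<Rightarrow> nat) \<Rightarrow> (nat \<times> nat) multiset" where
  "sym_monomial I \<rho> = image_mset (\<lambda>i. (min i (\<rho> i), max i (\<rho> i))) (mset_set I)"

definition mono_value :: "(nat \<Rightarrow> nat \<Rightarrow> real) \<Rightarrow> nat set \<Rightarrow> (nat \<Rightarrow> nat) \<Rightarrow> real" where
  "mono_value A I \<rho> = (\<Sum>i\<in>I. A i (\<rho> i))"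

definition sym_trop_singular :: "(nat \<Rightarrow> nat \<Rightarrow> real) \<Rightarrow> nat set \<Rightarrow> nat set \<Rightarrow> bool" where
  "sym_trop_singular A I J \<longleftrightarrow>
     (\<exists>\<rho>1 \<rho>2. bij_betw \<rho>1 I J \<and> bij_betw \<rho>2 I J \<and>
        sym_monomial I \<rho>1 \<noteq> sym_monomial I \<rho>2 \<and>
        mono_value A I \<rho>1 = mono_value A I \<rho>2 \<and>
        (\<forall>\<rho>. bij_betw \<rho> I J \<longrightarrow> mono_value A I \<rho>1 \<le> mono_value A I \<rho>))"

definition sym_minors_tropical_basis :: "nat \<Rightarrow> nat \<Rightarrow> bool" where
  "sym_minors_tropical_basis n r \<longleftrightarrow>
     (\<forall>A. sym_real_mat n A \<longrightarrow>
        ((\<forall>I J. I \<subseteq> {..<n} \<and> J \<subseteq> {..<n} \<and> card I = r \<and> card J = r \<longrightarrow> sym_trop_singular A I J)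
         \<longleftrightarrow> (\<exists>M. symmetric_lift n A M \<and> hahn_rank_lt n M r)))"

end

theory Submission
  imports Defs "Jordan_Normal_Form.Determinant" "HOL-Number_Theory.Cong"
begin

text \<open>For \<open>r = 4\<close> take the 3-adic valuations of the inner products of integer vectors representing
  the 13 points of the projective plane over the field with three elements. The integer
  Gram matrix has rank 3, and monomials of a symmetric 4 by 4 determinant have coefficients
  that are nonzero modulo 3, so all 4 by 4 submatrices are symmetrically singular. The constant
  coefficients of a lift of rank 3 would realise this plane over the complex numbers.

  For \<open>r > 4\<close> take a symmetric 6 by 6 matrix with three disjoint 2 by 2 blocks of zeros. Eliminating
  one row and column per block from a lift of rank 4 leaves a 3 by 3 matrix of rank 1, so the
  products along any two permutations agree; but the valuations of two such products are 3 and 4.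
  Bordering the matrix by a row and column with one small entry raises \<open>n\<close> and \<open>r\<close> together, and
  duplicating a row and column raises \<open>n\<close> alone.\<close>

section \<open>Pivoting and vanishing minors\<close>

text \<open>Only the passage from singular minors to a lift is refuted. In a symmetric determinant
  the terms of a permutation and of the one with a cycle reversed merge, so a monomial may carry the
  coefficient 2 or -2. Modulo 2 such a coefficient disappears, so the argument would break down for
  the Fano plane with 2-adic valuations. The next prime is 3, and its plane has 9 + 3 + 1 = 13
  points, which is the bound n > 12. For the larger r the blocks of zeros work in two ways. A 5 by 5
  submatrix omits one row and one column, hence leaves a block intact, and this block forces a tie.
  In a lift, a pivot from a block has valuation 0, so multiplying by it preserves valuations. The
  danger is cancellation; the entries outside the blocks keep six positions of the final 3 by 3
  matrix safe from it, enough for two permutations.\<close>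

definition minors_vanish :: "nat set \<Rightarrow> nat set \<Rightarrow> (nat \<Rightarrow> nat \<Rightarrow> 'a::comm_ring_1) \<Rightarrow> nat \<Rightarrow> bool" where
  "minors_vanish S T M r \<longleftrightarrow>
     (\<forall>u v. (\<forall>k<r. u k \<in> S \<and> v k \<in> T) \<longrightarrow> det (mat r r (\<lambda>(i, j). M (u i) (v j))) = 0)"

text \<open>Fraction-free elimination: \<open>M p q\<close> times the Schur complement entry, which
  makes sense in a ring without division. As a 2 by 2 minor it vanishes on row \<open>p\<close> and
  column \<open>q\<close>.\<close>

definition pivot :: "nat \<Rightarrow> nat \<Rightarrow> (nat \<Rightarrow> nat \<Rightarrow> 'a::comm_ring_1) \<Rightarrow> nat \<Rightarrow> nat \<Rightarrow> 'a" where
  "pivot p q M i j = M p q * M i j - M i q * M p j"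

lemma minors_vanish_mono:
  "minors_vanish S T M r \<Longrightarrow> S' \<subseteq> S \<Longrightarrow> T' \<subseteq> T \<Longrightarrow> minors_vanish S' T' M r"
  unfolding minors_vanish_def by blast

text \<open>Chio condensation. Left multiplication by the block triangular \<open>?L\<close> clears
  the column below the pivot entry \<open>a\<close> and multiplies the determinant by
  \<open>a ^ r\<close>; the lower block becomes the matrix \<open>E\<close> of pivots.\<close>

lemma det_chio:
  fixes M :: "nat \<Rightarrow> nat \<Rightarrow> 'a::idom"
  shows "M p q ^ r * det (mat (Suc r) (Suc r) (\<lambda>(i, j). M (case_nat p u i) (case_nat q v j)))
    = M p q * det (mat r r (\<lambda>(i, j). pivot p q M (u i) (v j)))"
proof -
  define a where "a = M p q"
  define A where "A = mat 1 1 (\<lambda>_. a)"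
  define B where "B = mat 1 r (\<lambda>(i, j). M p (v j))"
  define C where "C = mat r 1 (\<lambda>(i, j). M (u i) q)"
  define D where "D = mat r r (\<lambda>(i, j). M (u i) (v j))"
  define E where "E = mat r r (\<lambda>(i, j). pivot p q M (u i) (v j))"
  let ?L = "four_block_mat (1\<^sub>m 1) (0\<^sub>m 1 r) (- C) (a \<cdot>\<^sub>m 1\<^sub>m r)"
  let ?N = "four_block_mat A B C D"
  have carr: "A \<in> carrier_mat 1 1" "B \<in> carrier_mat 1 r" "C \<in> carrier_mat r 1"
    "D \<in> carrier_mat r r" "E \<in> carrier_mat r r"
    by (auto simp: A_def B_def C_def D_def E_def)
  have N: "?N = mat (Suc r) (Suc r) (\<lambda>(i, j). M (case_nat p u i) (case_nat q v j))"
    by (rule eq_matI) (auto simp: A_def B_def C_def D_def a_def split: nat.splits)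
  have aC: "a \<cdot>\<^sub>m 1\<^sub>m r * C = a \<cdot>\<^sub>m C" and aD: "a \<cdot>\<^sub>m 1\<^sub>m r * D = a \<cdot>\<^sub>m D"
    using mult_smult_assoc_mat[of "1\<^sub>m r" r r C 1 a] mult_smult_assoc_mat[of "1\<^sub>m r" r r D r a] carr
    by simp_all
  have CA: "- C * A + a \<cdot>\<^sub>m 1\<^sub>m r * C = 0\<^sub>m r 1"
    unfolding aC by (rule eq_matI) (auto simp: A_def C_def scalar_prod_def)
  have CB: "- C * B + a \<cdot>\<^sub>m 1\<^sub>m r * D = E"
    unfolding aD
    by (rule eq_matI) (auto simp: B_def C_def D_def E_def a_def pivot_def scalar_prod_def)
  have "?L * ?N = four_block_mat (1\<^sub>m 1 * A + 0\<^sub>m 1 r * C) (1\<^sub>m 1 * B + 0\<^sub>m 1 r * D)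
      (- C * A + a \<cdot>\<^sub>m 1\<^sub>m r * C) (- C * B + a \<cdot>\<^sub>m 1\<^sub>m r * D)"
    using carr by (intro mult_four_block_mat) auto
  then have LN: "?L * ?N = four_block_mat A B (0\<^sub>m r 1) E"
    unfolding CA CB using carr by simp
  have "det ?L = det (1\<^sub>m 1 :: 'a mat) * det (a \<cdot>\<^sub>m 1\<^sub>m r)"
    using carr by (intro det_four_block_mat_upper_right_zero) auto
  then have L: "det ?L = a ^ r" by simp
  have "det (?L * ?N) = det ?L * det ?N"
    using carr by (intro det_mult[of _ "1 + r"]) auto
  moreover have "det (four_block_mat A B (0\<^sub>m r 1) E) = det A * det E"
    using carr by (intro det_four_block_mat_lower_left_zero) auto
  moreover have "det A = a"
    by (simp add: A_def det_single)
  ultimately have "a ^ r * det ?N = a * det E"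
    by (simp only: LN L)
  then show ?thesis
    unfolding N by (simp only: a_def E_def)
qed

text \<open>Index maps in \<open>minors_vanish\<close> may repeat values, so \<open>p\<close> and
  \<open>q\<close> can be prepended to any choice of rows and columns. By \<open>det_chio\<close>
  the larger minor is the smaller one up to nonzero factors.\<close>

lemma minors_vanish_pivot:
  fixes M :: "nat \<Rightarrow> nat \<Rightarrow> 'a::idom"
  assumes van: "minors_vanish S T M (Suc r)" and pq: "p \<in> S" "q \<in> T" "M p q \<noteq> 0"
  shows "minors_vanish S T (pivot p q M) r"
  unfolding minors_vanish_def
proof (intro allI impI)
  fix u v assume "\<forall>k<r. u k \<in> S \<and> v k \<in> T"
  then have "\<forall>k<Suc r. case_nat p u k \<in> S \<and> case_nat q v k \<in> T"
    using pq by (auto split: nat.splits)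
  then have "det (mat (Suc r) (Suc r) (\<lambda>(i, j). M (case_nat p u i) (case_nat q v j))) = 0"
    using van unfolding minors_vanish_def by blast
  then show "det (mat r r (\<lambda>(i, j). pivot p q M (u i) (v j))) = 0"
    using det_chio[of M p q r u v] pq(3) by simp
qed

lemma minors_vanish_1D:
  assumes "minors_vanish S T M 1" "i \<in> S" "j \<in> T"
  shows "M i j = 0"
  using assms(1)[unfolded minors_vanish_def, rule_format, of "\<lambda>_. i" "\<lambda>_. j"] assms(2,3)
  by (simp add: det_single)

text \<open>Rank at most one. A nonzero entry among \<open>M i j\<close> and \<open>M i j'\<close>
  serves as pivot; if both vanish, so do both sides.\<close>

lemma minors_vanish_2D:
  fixes M :: "nat \<Rightarrow> nat \<Rightarrow> 'a::idom"
  assumes van: "minors_vanish S T M 2" and mem: "i \<in> S" "i' \<in> S" "j \<in> T" "j' \<in> T"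
  shows "M i j * M i' j' = M i j' * M i' j"
proof -
  have *: "M i k * M i' k' = M i k' * M i' k" if "M i k \<noteq> 0" "k \<in> T" "k' \<in> T" for k k'
    using minors_vanish_1D[OF minors_vanish_pivot[of S T M 1 i k], of i' k'] van mem that
    by (simp add: pivot_def numeral_2_eq_2 mult.commute[of "M i' k"])
  show ?thesis
    using *[of j j'] *[of j' j] mem by (metis mult_zero_left)
qed

section \<open>The ring of Hahn series\<close>

lemma well_ordered_real_subset: "well_ordered_real S \<Longrightarrow> T \<subseteq> S \<Longrightarrow> well_ordered_real T"
  unfolding well_ordered_real_def by blast

lemma well_ordered_realD:
  "well_ordered_real S \<Longrightarrow> B \<subseteq> S \<Longrightarrow> B \<noteq> {} \<Longrightarrow> \<exists>m\<in>B. \<forall>b\<in>B. m \<le> b"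
  unfolding well_ordered_real_def by simp

lemma no_decseq_in_well_ordered_real:
  fixes f :: "nat \<Rightarrow> real"
  assumes "well_ordered_real S" "\<And>n. f n \<in> S" "\<And>m n. N \<le> m \<Longrightarrow> m < n \<Longrightarrow> f n < f m"
  shows False
proof -
  have "f ` {N..} \<subseteq> S" "f N \<in> f ` {N..}"
    using assms(2) by auto
  then obtain k where k: "k \<ge> N" "\<And>n. n \<ge> N \<Longrightarrow> f k \<le> f n"
    using well_ordered_realD[OF assms(1), of "f ` {N..}"] by auto
  show False
    using assms(3)[of k "Suc k"] k(1) k(2)[of "Suc k"] by linarith
qed

text \<open>Among the points with infinitely many elements of \<open>B\<close> below them take the
  least one, \<open>m\<close>. The greatest element below \<open>m\<close> still has infinitely many
  below it, a contradiction.\<close>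

lemma finite_if_all_subsets_have_min_max:
  fixes B :: "real set"
  assumes min: "\<And>C. C \<subseteq> B \<Longrightarrow> C \<noteq> {} \<Longrightarrow> \<exists>m\<in>C. \<forall>b\<in>C. m \<le> b"
    and max: "\<And>C. C \<subseteq> B \<Longrightarrow> C \<noteq> {} \<Longrightarrow> \<exists>m\<in>C. \<forall>b\<in>C. b \<le> m"
  shows "finite B"
proof (rule ccontr)
  assume inf: "infinite B"
  define C where "C = {x\<in>B. infinite {y\<in>B. y < x}}"
  have "B \<noteq> {}" using inf by auto
  then obtain b where b: "b \<in> B" "\<forall>y\<in>B. y \<le> b" using max[of B] by auto
  have "B \<subseteq> insert b {y\<in>B. y < b}" using b by force
  then have "infinite {y\<in>B. y < b}" using inf by (meson finite_insert finite_subset)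
  then have "b \<in> C" using b C_def by auto
  then obtain m where m: "m \<in> C" "\<forall>x\<in>C. m \<le> x" using min[of C] C_def by auto
  have infm: "infinite {y\<in>B. y < m}" using m C_def by auto
  then have "{y\<in>B. y < m} \<noteq> {}" using infinite_imp_nonempty by blast
  then obtain k where k: "k \<in> B" "k < m" "\<forall>y\<in>B. y < m \<longrightarrow> y \<le> k"
    using max[of "{y\<in>B. y < m}"] by auto
  have "{y\<in>B. y < m} \<subseteq> insert k {y\<in>B. y < k}" using k by force
  then have "infinite {y\<in>B. y < k}" using infm by (meson finite_insert finite_subset)
  then have "k \<in> C" using k C_def by auto
  then show False using m k by force
qed

text \<open>Least elements come from \<open>S\<close>, and since \<open>c - a\<close> ranges over
  \<open>T\<close>, greatest ones come from \<open>T\<close>. This makes each coefficient of a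
  product a finite sum.\<close>

lemma finite_well_ordered_diff:
  assumes S: "well_ordered_real S" and T: "well_ordered_real T"
  shows "finite {a\<in>S. c - a \<in> T}"
proof (rule finite_if_all_subsets_have_min_max)
  fix C assume C: "C \<subseteq> {a\<in>S. c - a \<in> T}" "C \<noteq> {}"
  show "\<exists>m\<in>C. \<forall>b\<in>C. m \<le> b"
    using C by (intro well_ordered_realD[OF S]) auto
  have "(\<lambda>a. c - a) ` C \<subseteq> T" "(\<lambda>a. c - a) ` C \<noteq> {}" using C by auto
  then have "\<exists>m\<in>(\<lambda>a. c - a) ` C. \<forall>b\<in>(\<lambda>a. c - a) ` C. m \<le> b"
    by (rule well_ordered_realD[OF T])
  then show "\<exists>m\<in>C. \<forall>b\<in>C. b \<le> m" by force
qed

text \<open>A strictly decreasing sequence of sums has a subsequence with monotone summands from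
  \<open>S\<close>. A nonincreasing sequence in a well-ordered set becomes constant, so these
  summands are eventually nondecreasing in either case, and those from \<open>T\<close> strictly
  decrease.\<close>

lemma well_ordered_real_plus:
  assumes S: "well_ordered_real S" and T: "well_ordered_real T"
  shows "well_ordered_real {s + t | s t. s \<in> S \<and> t \<in> T}"
  unfolding well_ordered_real_def
proof (intro allI impI, rule ccontr)
  fix B assume B: "B \<subseteq> {s + t | s t. s \<in> S \<and> t \<in> T}" "B \<noteq> {}"
    and no: "\<not> (\<exists>m\<in>B. \<forall>b\<in>B. m \<le> b)"
  obtain b0 where b0: "b0 \<in> B" using B by auto
  have "\<forall>b. \<exists>b'. b \<in> B \<longrightarrow> b' \<in> B \<and> b' < b" using no by (meson not_le)
  then obtain nx where nx: "\<And>b. b \<in> B \<Longrightarrow> nx b \<in> B \<and> nx b < b" by metis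
  define x where "x n = (nx ^^ n) b0" for n
  have xB: "x n \<in> B" for n by (induction n) (use b0 nx in \<open>auto simp: x_def\<close>)
  have "x (Suc n) < x n" for n using nx[OF xB[of n]] by (simp add: x_def)
  then have dec: "m < n \<Longrightarrow> x n < x m" for m n
    using lift_Suc_mono_less[of "\<lambda>n. - x n" m n] by simp
  have "\<forall>n. \<exists>s t. s \<in> S \<and> t \<in> T \<and> x n = s + t" using xB B(1) by blast
  then obtain s t where st: "\<And>n. s n \<in> S" "\<And>n. t n \<in> T" "\<And>n. x n = s n + t n" by metis
  obtain f where f: "strict_mono f" "monoseq (\<lambda>n. s (f n))"
    using seq_monosub[of s] by blast
  have td: False if "\<And>m n. N \<le> m \<Longrightarrow> m \<le> n \<Longrightarrow> s (f m) \<le> s (f n)" for N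
  proof (rule no_decseq_in_well_ordered_real[OF T, of "\<lambda>n. t (f n)" N])
    fix m n assume mn: "N \<le> m" "m < n"
    have "x (f n) < x (f m)" using dec f(1) mn(2) by (simp add: strict_mono_less)
    then show "t (f n) < t (f m)" using that[of m n] mn st(3)[of "f n"] st(3)[of "f m"] by simp
  qed (use st in auto)
  show False
  proof (cases "incseq (\<lambda>n. s (f n))")
    case True
    then show False using td[of 0] by (auto simp: incseq_def)
  next
    case False
    then have ds: "\<And>m n. m \<le> n \<Longrightarrow> s (f n) \<le> s (f m)"
      using f(2) unfolding monoseq_def incseq_def by blast
    have "(\<lambda>n. s (f n)) ` UNIV \<subseteq> S" "(\<lambda>n. s (f n)) ` UNIV \<noteq> {}" using st(1) by auto
    then obtain N where N: "\<And>n. s (f N) \<le> s (f n)"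
      using well_ordered_realD[OF S, of "range (\<lambda>n. s (f n))"] by auto
    show False by (rule td[of N]) (use N ds order_trans in blast)
  qed
qed

lemma well_ordered_real_Un:
  assumes "well_ordered_real S" "well_ordered_real T"
  shows "well_ordered_real (S \<union> T)"
  unfolding well_ordered_real_def
proof (intro allI impI)
  fix B assume B: "B \<subseteq> S \<union> T" "B \<noteq> {}"
  have ex: "\<exists>m\<in>C. \<forall>b\<in>C. m \<le> b" if "C \<subseteq> S \<or> C \<subseteq> T" "C \<noteq> {}" for C
    using that well_ordered_realD assms by blast
  show "\<exists>m\<in>B. \<forall>b\<in>B. m \<le> b"
  proof (cases "B \<subseteq> S \<or> B \<subseteq> T")
    case True
    then show ?thesis using ex[of B] B by blast
  next
    case False
    then have "B \<inter> S \<noteq> {}" "B \<inter> T \<noteq> {}" using B by auto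
    then obtain m m' where m: "m \<in> B" "\<forall>b\<in>B \<inter> S. m \<le> b" "m' \<in> B" "\<forall>b\<in>B \<inter> T. m' \<le> b"
      using ex[of "B \<inter> S"] ex[of "B \<inter> T"] by blast
    then have "\<forall>b\<in>B. min m m' \<le> b" using B by (auto simp: min_le_iff_disj)
    moreover have "min m m' \<in> B" using m by (simp add: min_def)
    ultimately show ?thesis by blast
  qed
qed

text \<open>The statement uses raw coefficient functions. A type of its own becomes an instance of
  \<open>idom\<close>, so that library determinants and elimination apply to Hahn series.\<close>

typedef hahn = "{f. is_hahn f}" morphisms hcoeff Abs_hahn
  by (rule exI[of _ "\<lambda>_. 0"]) (simp add: is_hahn_def hahn_support_def well_ordered_real_def)

lemma hcoeff_Abs_hahn: "is_hahn f \<Longrightarrow> hcoeff (Abs_hahn f) = f"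
  by (simp add: Abs_hahn_inverse)

lemma is_hahn_hcoeff: "is_hahn (hcoeff f)"
  using hcoeff by simp

lemma hahn_eqI: "(\<And>a. hcoeff f a = hcoeff g a) \<Longrightarrow> f = g"
  by (auto simp: hcoeff_inject[symmetric])

abbreviation hsupp :: "hahn \<Rightarrow> real set" where
  "hsupp f \<equiv> hahn_support (hcoeff f)"

lemma well_ordered_hsupp: "well_ordered_real (hsupp f)"
  using is_hahn_hcoeff by (simp add: is_hahn_def)

text \<open>Exponents are restricted to both supports, which leaves finitely many for Hahn series; a
  \<open>sum\<close> over an infinite set would be 0 by convention.\<close>

definition hahn_times :: "(real \<Rightarrow> complex) \<Rightarrow> (real \<Rightarrow> complex) \<Rightarrow> real \<Rightarrow> complex" where
  "hahn_times f g c = (\<Sum>a\<in>{a \<in> hahn_support f. c - a \<in> hahn_support g}. f a * g (c - a))"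

lemma hahn_support_hahn_times:
  assumes "c \<in> hahn_support (hahn_times f g)"
  shows "\<exists>a. a \<in> hahn_support f \<and> c - a \<in> hahn_support g"
proof (rule ccontr)
  assume "\<not> ?thesis"
  then have "{a \<in> hahn_support f. c - a \<in> hahn_support g} = {}" by blast
  then have "hahn_times f g c = 0" by (simp only: hahn_times_def sum.empty)
  then show False using assms by (simp add: hahn_support_def)
qed

lemma is_hahn_times:
  assumes "is_hahn f" "is_hahn g"
  shows "is_hahn (hahn_times f g)"
proof -
  have "hahn_support (hahn_times f g) \<subseteq> {s + t | s t. s \<in> hahn_support f \<and> t \<in> hahn_support g}"
  proof
    fix c assume "c \<in> hahn_support (hahn_times f g)"
    then obtain a where "a \<in> hahn_support f" "c - a \<in> hahn_support g"
      using hahn_support_hahn_times by blast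
    then show "c \<in> {s + t | s t. s \<in> hahn_support f \<and> t \<in> hahn_support g}"
      by (intro CollectI exI[of _ a] exI[of _ "c - a"]) simp
  qed
  then show ?thesis
    using assms well_ordered_real_plus well_ordered_real_subset unfolding is_hahn_def by blast
qed

section \<open>Ring structure on Hahn series\<close>

instantiation hahn :: comm_ring_1
begin

definition zero_hahn :: hahn where "0 = Abs_hahn (\<lambda>_. 0)"
definition one_hahn :: hahn where "1 = Abs_hahn (\<lambda>a. if a = 0 then 1 else 0)"
definition plus_hahn :: "hahn \<Rightarrow> hahn \<Rightarrow> hahn" where
  "f + g = Abs_hahn (\<lambda>a. hcoeff f a + hcoeff g a)"
definition uminus_hahn :: "hahn \<Rightarrow> hahn" where
  "- f = Abs_hahn (\<lambda>a. - hcoeff f a)"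
definition minus_hahn :: "hahn \<Rightarrow> hahn \<Rightarrow> hahn" where
  "f - g = Abs_hahn (\<lambda>a. hcoeff f a - hcoeff g a)"
definition times_hahn :: "hahn \<Rightarrow> hahn \<Rightarrow> hahn" where
  "f * g = Abs_hahn (hahn_times (hcoeff f) (hcoeff g))"

lemma hcoeff_zero [simp]: "hcoeff 0 a = 0"
  unfolding zero_hahn_def
  by (subst hcoeff_Abs_hahn) (simp_all add: is_hahn_def hahn_support_def well_ordered_real_def)

lemma hcoeff_one: "hcoeff 1 a = (if a = 0 then 1 else 0)"
  unfolding one_hahn_def
  by (subst hcoeff_Abs_hahn) (auto simp: is_hahn_def hahn_support_def well_ordered_real_def)

lemma hcoeff_plus [simp]: "hcoeff (f + g) a = hcoeff f a + hcoeff g a"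
proof -
  have "hahn_support (\<lambda>a. hcoeff f a + hcoeff g a) \<subseteq> hsupp f \<union> hsupp g"
    by (auto simp: hahn_support_def)
  then have "is_hahn (\<lambda>a. hcoeff f a + hcoeff g a)"
    unfolding is_hahn_def
    using well_ordered_real_Un[OF well_ordered_hsupp well_ordered_hsupp] well_ordered_real_subset by blast
  then show ?thesis by (simp add: plus_hahn_def hcoeff_Abs_hahn)
qed

lemma hcoeff_uminus [simp]: "hcoeff (- f) a = - hcoeff f a"
proof -
  have "is_hahn (\<lambda>a. - hcoeff f a)"
    using well_ordered_hsupp[of f] by (simp add: is_hahn_def hahn_support_def)
  then show ?thesis by (simp add: uminus_hahn_def hcoeff_Abs_hahn)
qed

lemma hcoeff_minus [simp]: "hcoeff (f - g) a = hcoeff f a - hcoeff g a"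
proof -
  have "f - g = f + (- g)" by (simp add: minus_hahn_def plus_hahn_def)
  then show ?thesis by simp
qed

lemma hcoeff_times_fun: "hcoeff (f * g) = hahn_times (hcoeff f) (hcoeff g)"
  by (simp add: times_hahn_def hcoeff_Abs_hahn is_hahn_times is_hahn_hcoeff)

lemma hcoeff_times: "hcoeff (f * g) c = (\<Sum>a\<in>{a \<in> hsupp f. c - a \<in> hsupp g}. hcoeff f a * hcoeff g (c - a))"
  by (simp add: hcoeff_times_fun hahn_times_def)

lemma hcoeff_times_superset:
  assumes "finite A" "{a \<in> hsupp f. c - a \<in> hsupp g} \<subseteq> A"
  shows "hcoeff (f * g) c = (\<Sum>a\<in>A. hcoeff f a * hcoeff g (c - a))"
  unfolding hcoeff_times using assms
  by (intro sum.mono_neutral_left) (auto simp: hahn_support_def)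

lemma hahn_times_commute: "f * g = g * (f::hahn)"
proof (rule hahn_eqI)
  fix c show "hcoeff (f * g) c = hcoeff (g * f) c"
    unfolding hcoeff_times
    by (rule sum.reindex_bij_witness[of _ "\<lambda>a. c - a" "\<lambda>a. c - a"]) (auto simp: mult.commute)
qed

text \<open>This form is symmetric in the three factors: associativity then amounts to commutativity
  and a cyclic relabelling of the exponents \<open>a\<close>, \<open>b\<close> and
  \<open>c - a - b\<close>.\<close>

lemma hcoeff_times_times:
  "hcoeff (f * g * h) c = (\<Sum>(a, b)\<in>{(a, b). a \<in> hsupp f \<and> b \<in> hsupp g \<and> c - a - b \<in> hsupp h}.
     hcoeff f a * hcoeff g b * hcoeff h (c - a - b))"
proof -
  \<comment> \<open>Cancellation can make the support of \<open>f * g\<close> smaller than the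
    sumset; summing over the full sumset keeps every pair of exponents available.\<close>
  define D where "D = {d \<in> {s + t | s t. s \<in> hsupp f \<and> t \<in> hsupp g}. c - d \<in> hsupp h}"
  have fD: "finite D"
    unfolding D_def
    by (intro finite_well_ordered_diff well_ordered_real_plus well_ordered_hsupp)
  have sub: "{d \<in> hsupp (f * g). c - d \<in> hsupp h} \<subseteq> D"
  proof
    fix d assume d: "d \<in> {d \<in> hsupp (f * g). c - d \<in> hsupp h}"
    then obtain a where "a \<in> hsupp f" "d - a \<in> hsupp g"
      using hahn_support_hahn_times[of d "hcoeff f" "hcoeff g"] by (auto simp: hcoeff_times_fun)
    then have "d \<in> {s + t | s t. s \<in> hsupp f \<and> t \<in> hsupp g}"
      by (intro CollectI exI[of _ a] exI[of _ "d - a"]) simp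
    then show "d \<in> D" using d unfolding D_def by blast
  qed
  have "hcoeff (f * g * h) c = (\<Sum>d\<in>D. hcoeff (f * g) d * hcoeff h (c - d))"
    by (rule hcoeff_times_superset[OF fD sub])
  also have "\<dots> = (\<Sum>d\<in>D. \<Sum>a\<in>{a \<in> hsupp f. d - a \<in> hsupp g}. hcoeff f a * hcoeff g (d - a) * hcoeff h (c - d))"
    by (simp add: hcoeff_times sum_distrib_right)
  also have "\<dots> = (\<Sum>(d, a)\<in>(SIGMA d:D. {a \<in> hsupp f. d - a \<in> hsupp g}).
      hcoeff f a * hcoeff g (d - a) * hcoeff h (c - d))"
    by (rule sum.Sigma[OF fD]) (simp add: finite_well_ordered_diff well_ordered_hsupp)
  also have "\<dots> = (\<Sum>(a, b)\<in>{(a, b). a \<in> hsupp f \<and> b \<in> hsupp g \<and> c - a - b \<in> hsupp h}.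
     hcoeff f a * hcoeff g b * hcoeff h (c - a - b))"
    by (rule sum.reindex_bij_witness[of _ "\<lambda>(a, b). (a + b, a)" "\<lambda>(d, a). (a, d - a)"])
      (auto simp: D_def diff_diff_eq)
  finally show ?thesis .
qed

instance
proof
  fix f g h :: hahn
  show "f * g * h = f * (g * h)"
  proof (rule hahn_eqI)
    fix c
    have "hcoeff (f * (g * h)) c = hcoeff (g * h * f) c" by (simp add: hahn_times_commute)
    also have "\<dots> = hcoeff (f * g * h) c"
      unfolding hcoeff_times_times
      by (rule sum.reindex_bij_witness[of _ "\<lambda>(a, b). (b, c - a - b)" "\<lambda>(b, e). (c - b - e, b)"])
        (auto simp: algebra_simps)
    finally show "hcoeff (f * g * h) c = hcoeff (f * (g * h)) c" by simp
  qed
  show "f * g = g * f" by (rule hahn_times_commute)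
  show "1 * f = f"
  proof (rule hahn_eqI)
    fix c
    have "hcoeff (1 * f) c = (\<Sum>a\<in>{0}. hcoeff 1 a * hcoeff f (c - a))"
      by (rule hcoeff_times_superset) (auto simp: hahn_support_def hcoeff_one)
    then show "hcoeff (1 * f) c = hcoeff f c" by (simp add: hcoeff_one)
  qed
  show "(f + g) * h = f * h + g * h"
  proof (rule hahn_eqI)
    fix c
    define A where "A = {a \<in> hsupp f. c - a \<in> hsupp h} \<union> {a \<in> hsupp g. c - a \<in> hsupp h}"
    have A: "finite A" unfolding A_def by (simp add: finite_well_ordered_diff well_ordered_hsupp)
    have "hcoeff (k * h) c = (\<Sum>a\<in>A. hcoeff k a * hcoeff h (c - a))" if "k = f \<or> k = g \<or> k = f + g" for k
      using that by (intro hcoeff_times_superset A) (auto simp: A_def hahn_support_def)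
    then show "hcoeff ((f + g) * h) c = hcoeff (f * h + g * h) c"
      by (simp add: distrib_right sum.distrib)
  qed
  have "hcoeff (0::hahn) 0 \<noteq> hcoeff 1 0" by (simp add: hcoeff_one)
  then show "(0::hahn) \<noteq> 1" by metis
qed (auto intro!: hahn_eqI)

end

text \<open>Bounds and exact valuations are relations: 0 satisfies every bound and has no valuation,
  and elimination can keep entries of which only a bound is known.\<close>

definition val_ge :: "hahn \<Rightarrow> real \<Rightarrow> bool" where
  "val_ge f d \<longleftrightarrow> (\<forall>a<d. hcoeff f a = 0)"

definition has_val :: "hahn \<Rightarrow> real \<Rightarrow> bool" where
  "has_val f d \<longleftrightarrow> val_ge f d \<and> hcoeff f d \<noteq> 0"

text \<open>Below \<open>d + e\<close> no pair of exponents is left, and at \<open>d + e\<close>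
  only \<open>(d, e)\<close>; hence lowest coefficients multiply.\<close>

lemma hcoeff_times_val_ge:
  assumes "val_ge f d" "val_ge g e"
  shows "val_ge (f * g) (d + e)" "hcoeff (f * g) (d + e) = hcoeff f d * hcoeff g e"
proof -
  have ge: "a \<in> hsupp f \<Longrightarrow> d \<le> a" "a \<in> hsupp g \<Longrightarrow> e \<le> a" for a
    using assms by (simp_all add: val_ge_def hahn_support_def) (meson not_le)+
  show "val_ge (f * g) (d + e)"
    unfolding val_ge_def
  proof (intro allI impI)
    fix c assume "c < d + e"
    then have "False" if "a \<in> hsupp f" "c - a \<in> hsupp g" for a
      using ge(1)[OF that(1)] ge(2)[OF that(2)] by linarith
    then have "{a \<in> hsupp f. c - a \<in> hsupp g} = {}" by blast
    then show "hcoeff (f * g) c = 0" by (simp only: hcoeff_times sum.empty)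
  qed
  have "a = d" if "a \<in> hsupp f" "d + e - a \<in> hsupp g" for a
    using ge(1)[OF that(1)] ge(2)[OF that(2)] by linarith
  then have "hcoeff (f * g) (d + e) = (\<Sum>a\<in>{d}. hcoeff f a * hcoeff g (d + e - a))"
    by (intro hcoeff_times_superset) blast+
  then show "hcoeff (f * g) (d + e) = hcoeff f d * hcoeff g e" by simp
qed

lemma has_val_times: "has_val f d \<Longrightarrow> has_val g e \<Longrightarrow> has_val (f * g) (d + e)"
  by (simp add: has_val_def hcoeff_times_val_ge)

lemma has_val_nonzero: "has_val f d \<Longrightarrow> f \<noteq> 0"
  by (auto simp: has_val_def)

lemma has_val_unique: "has_val f d \<Longrightarrow> has_val f e \<Longrightarrow> d = e"
  by (cases d e rule: linorder_cases) (auto simp: has_val_def val_ge_def)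

lemma val_ge_mono: "val_ge f d \<Longrightarrow> e \<le> d \<Longrightarrow> val_ge f e"
  by (simp add: val_ge_def)

lemma val_ge_diff: "val_ge f d \<Longrightarrow> val_ge g d \<Longrightarrow> val_ge (f - g) d"
  by (simp add: val_ge_def)

lemma has_val_diff: "has_val f d \<Longrightarrow> val_ge g e \<Longrightarrow> d < e \<Longrightarrow> has_val (f - g) d"
  by (simp add: has_val_def val_ge_def)

lemma has_val_hahn_deg:
  assumes "is_hahn f" "f \<noteq> (\<lambda>_. 0)"
  shows "has_val (Abs_hahn f) (hahn_deg f)"
proof -
  have "hahn_support f \<noteq> {}" using assms(2) by (auto simp: hahn_support_def)
  then obtain m where m: "f m \<noteq> 0" "\<And>a. f a \<noteq> 0 \<Longrightarrow> m \<le> a"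
    using well_ordered_realD[of "hahn_support f" "hahn_support f"] assms(1)
    by (auto simp: is_hahn_def hahn_support_def)
  then have "hahn_deg f = m" unfolding hahn_deg_def by (intro Least_equality) auto
  then show ?thesis
    using m by (fastforce simp: has_val_def val_ge_def hcoeff_Abs_hahn[OF assms(1)])
qed

lemma has_val_exists:
  assumes "f \<noteq> 0"
  shows "\<exists>d. has_val f d"
proof -
  have "hcoeff f \<noteq> (\<lambda>_. 0)" using assms hahn_eqI[of f 0] by auto
  then have "has_val (Abs_hahn (hcoeff f)) (hahn_deg (hcoeff f))"
    by (intro has_val_hahn_deg is_hahn_hcoeff)
  then show ?thesis by (auto simp: hcoeff_inverse)
qed

instance hahn :: idom
proof
  fix f g :: hahn assume "f \<noteq> 0" "g \<noteq> 0"
  then show "f * g \<noteq> 0"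
    using has_val_exists[of f] has_val_exists[of g] has_val_times has_val_nonzero by blast
qed

text \<open>Links the product of the statement with the product in the type. The induction also
  carries that the set \<open>Y\<close> of attainable exponent sums is well-ordered and that the
  fibres \<open>F\<close> are finite; both are needed to regroup the sum.\<close>

lemma hahn_prod_eq_hcoeff_prod:
  assumes "finite I" "\<And>i. i \<in> I \<Longrightarrow> is_hahn (f i)"
  shows "hahn_prod I f g = hcoeff (\<Prod>i\<in>I. Abs_hahn (f i)) g"
proof -
  define F where "F I g = {a \<in> PiE I (\<lambda>i. hahn_support (f i)). (\<Sum>i\<in>I. a i) = g}" for I g
  define Y where "Y I = {g. F I g \<noteq> {}}" for I
  have "well_ordered_real (Y I) \<and> (\<forall>g. finite (F I g)) \<and>
      (\<forall>g. hcoeff (\<Prod>i\<in>I. Abs_hahn (f i)) g = (\<Sum>a\<in>F I g. \<Prod>i\<in>I. f i (a i)))"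
    using assms
  proof (induction I rule: finite_induct)
    case empty
    have "F {} g = (if g = 0 then {\<lambda>_. undefined} else {})" for g
      by (auto simp: F_def)
    then show ?case
      by (auto simp: Y_def hcoeff_one well_ordered_real_def)
  next
    case (insert i I)
    define S where "S = hahn_support (f i)"
    have S: "well_ordered_real S" using insert.prems by (simp add: S_def is_hahn_def)
    have IH: "well_ordered_real (Y I)" "\<And>g. finite (F I g)"
      "\<And>g. hcoeff (\<Prod>i\<in>I. Abs_hahn (f i)) g = (\<Sum>a\<in>F I g. \<Prod>i\<in>I. f i (a i))"
      using insert by auto
    have ci: "hcoeff (Abs_hahn (f i)) = f i" using insert.prems by (simp add: hcoeff_Abs_hahn)
    define X where "X g = {x \<in> S. g - x \<in> Y I}" for g
    have fX: "finite (X g)" for g unfolding X_def by (rule finite_well_ordered_diff[OF S IH(1)])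
    define B where "B g = (SIGMA x:X g. F I (g - x))" for g
    have fB: "finite (B g)" for g unfolding B_def using fX IH(2) by blast
    have sum_upd: "(\<Sum>k\<in>I. if k = i then x else a k) = (\<Sum>k\<in>I. a k)" for x :: real and a
      using insert.hyps(2) by (intro sum.cong) auto
    \<comment> \<open>A choice of exponents on \<open>insert i I\<close> splits into its value at
      \<open>i\<close> and the rest; the value \<open>undefined\<close> at \<open>i\<close> makes
      the rest extensional on \<open>I\<close>.\<close>
    have bij: "bij_betw (\<lambda>(x, a). a(i := x)) (B g) (F (insert i I) g)" for g
    proof (rule bij_betw_byWitness[where f' = "\<lambda>a. (a i, a(i := undefined))"])
      show "\<forall>p\<in>B g. (\<lambda>a. (a i, a(i := undefined))) ((\<lambda>(x, a). a(i := x)) p) = p"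
        using insert.hyps(2) by (auto simp: B_def F_def PiE_def extensional_def fun_eq_iff)
      show "\<forall>a\<in>F (insert i I) g. (\<lambda>(x, a). a(i := x)) (a i, a(i := undefined)) = a" by auto
      show "(\<lambda>(x, a). a(i := x)) ` B g \<subseteq> F (insert i I) g"
        using insert.hyps
        by (auto simp: B_def F_def X_def S_def PiE_def extensional_def sum_upd Pi_def)
      show "(\<lambda>a. (a i, a(i := undefined))) ` F (insert i I) g \<subseteq> B g"
      proof clarify
        fix a assume a: "a \<in> F (insert i I) g"
        have "a(i := undefined) \<in> PiE I (\<lambda>i. hahn_support (f i))"
          using a insert.hyps(2) by (auto simp: F_def PiE_def extensional_def Pi_def)
        moreover have "(\<Sum>k\<in>I. (a(i := undefined)) k) = (\<Sum>k\<in>I. a k)"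
          using insert.hyps(2) by (intro sum.cong) auto
        moreover have "a i + (\<Sum>k\<in>I. a k) = g" using a insert.hyps by (simp add: F_def)
        ultimately have "a(i := undefined) \<in> F I (g - a i)" by (simp add: F_def)
        moreover have "a i \<in> S" using a by (auto simp: F_def S_def)
        ultimately show "(a i, a(i := undefined)) \<in> B g" by (auto simp: B_def X_def Y_def)
      qed
    qed
    have fin: "finite (F (insert i I) g)" for g
      using bij_betw_finite[OF bij] fB by blast
    have "Y (insert i I) \<subseteq> {s + t | s t. s \<in> S \<and> t \<in> Y I}"
    proof
      fix g assume "g \<in> Y (insert i I)"
      then have "B g \<noteq> {}" using bij[of g] unfolding Y_def by (auto simp: bij_betw_def)
      then obtain x where "x \<in> S" "g - x \<in> Y I" by (auto simp: B_def X_def)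
      then show "g \<in> {s + t | s t. s \<in> S \<and> t \<in> Y I}" by (intro CollectI exI[of _ x] exI[of _ "g - x"]) simp
    qed
    then have "well_ordered_real (Y (insert i I))"
      using well_ordered_real_plus[OF S IH(1)] well_ordered_real_subset by blast
    moreover have "hcoeff (\<Prod>i\<in>insert i I. Abs_hahn (f i)) g
        = (\<Sum>a\<in>F (insert i I) g. \<Prod>i\<in>insert i I. f i (a i))" for g
    proof -
      have supp: "hsupp (\<Prod>i\<in>I. Abs_hahn (f i)) \<subseteq> Y I"
        using IH(3) by (auto simp: hahn_support_def Y_def)
      have "hcoeff (\<Prod>i\<in>insert i I. Abs_hahn (f i)) g = hcoeff (Abs_hahn (f i) * (\<Prod>i\<in>I. Abs_hahn (f i))) g"
        using insert.hyps by simp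
      also have "\<dots> = (\<Sum>x\<in>X g. f i x * hcoeff (\<Prod>i\<in>I. Abs_hahn (f i)) (g - x))"
        using supp by (subst hcoeff_times_superset[OF fX[of g]]) (auto simp: X_def S_def ci)
      also have "\<dots> = (\<Sum>x\<in>X g. \<Sum>a\<in>F I (g - x). f i x * (\<Prod>i\<in>I. f i (a i)))"
        by (simp add: IH(3) sum_distrib_left)
      also have "\<dots> = (\<Sum>(x, a)\<in>B g. f i x * (\<Prod>i\<in>I. f i (a i)))"
        unfolding B_def by (rule sum.Sigma[OF fX]) (simp add: IH(2))
      also have "\<dots> = (\<Sum>(x, a)\<in>B g. \<Prod>k\<in>insert i I. f k ((a(i := x)) k))"
      proof (intro sum.cong refl, clarify)
        fix x a
        have "(\<Prod>k\<in>I. f k ((a(i := x)) k)) = (\<Prod>k\<in>I. f k (a k))"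
          using insert.hyps(2) by (intro prod.cong) auto
        then show "f i x * (\<Prod>i\<in>I. f i (a i)) = (\<Prod>k\<in>insert i I. f k ((a(i := x)) k))"
          using insert.hyps by simp
      qed
      also have "\<dots> = (\<Sum>a\<in>F (insert i I) g. \<Prod>k\<in>insert i I. f k (a k))"
        using sum.reindex_bij_betw[OF bij[of g], of "\<lambda>a. \<Prod>k\<in>insert i I. f k (a k)"]
        by (simp add: case_prod_unfold)
      finally show ?thesis .
    qed
    ultimately show ?case using fin by blast
  qed
  then show ?thesis by (simp add: hahn_prod_def F_def)
qed

text \<open>As \<open>d\<close> bounds the supports from below, exponents with the sum of
  \<open>d\<close> must equal \<open>d\<close>. If \<open>d\<close> misses some support, the sum is
  empty and the product on the right is 0 as well.\<close>

lemma hahn_prod_lowest: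
  assumes "finite I" "\<And>i a. i \<in> I \<Longrightarrow> a < d i \<Longrightarrow> f i a = 0"
  shows "hahn_prod I f (\<Sum>i\<in>I. d i) = (\<Prod>i\<in>I. f i (d i))"
proof -
  let ?F = "{a \<in> PiE I (\<lambda>i. hahn_support (f i)). (\<Sum>i\<in>I. a i) = (\<Sum>i\<in>I. d i)}"
  have "a = restrict d I" if a: "a \<in> ?F" for a
  proof -
    have aP: "a \<in> PiE I (\<lambda>i. hahn_support (f i))" using a by simp
    have ge: "d i \<le> a i" if "i \<in> I" for i
    proof -
      have "f i (a i) \<noteq> 0" using PiE_mem[OF aP that] by (simp add: hahn_support_def)
      then show ?thesis using assms(2)[OF that, of "a i"] by (meson not_le)
    qed
    have "d i = a i" if "i \<in> I" for i
      using sum_mono_inv[of d I a i] a ge assms(1) that by simp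
    then show ?thesis
      using aP by (intro extensionalityI[of a I]) (auto simp: PiE_def)
  qed
  then have sub: "?F \<subseteq> {restrict d I}" by blast
  have zero: "(\<Prod>i\<in>I. f i (restrict d I i)) = 0" if "restrict d I \<notin> ?F"
  proof -
    have "restrict d I \<notin> PiE I (\<lambda>i. hahn_support (f i))" using that by simp
    then obtain i where "i \<in> I" "f i (restrict d I i) = 0"
      by (force simp: restrict_PiE_iff hahn_support_def)
    then show ?thesis using assms(1) by (intro prod_zero) blast+
  qed
  have "hahn_prod I f (\<Sum>i\<in>I. d i) = (\<Sum>a\<in>{restrict d I}. \<Prod>i\<in>I. f i (a i))"
    unfolding hahn_prod_def
    by (rule sum.mono_neutral_left[OF _ sub]) (use zero in blast)+
  also have "\<dots> = (\<Prod>i\<in>I. f i (d i))" by simp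
  finally show ?thesis .
qed

section \<open>Symmetric tropical singularity\<close>

lemma unordered_pair_eq_iff:
  fixes i j k l :: nat
  shows "(min i j, max i j) = (min k l, max k l) \<longleftrightarrow> i = k \<and> j = l \<or> i = l \<and> j = k"
  by (auto simp: min_def max_def)

text \<open>There are infinitely many total functions that are bijections from \<open>I\<close> to
  \<open>J\<close>, but the value depends only on the restriction to \<open>I\<close>.\<close>

lemma exists_minimal_bijection:
  assumes fin: "finite I" "finite J" and card: "card I = card J"
  obtains \<rho> where "bij_betw \<rho> I J" "\<And>\<sigma>. bij_betw \<sigma> I J \<Longrightarrow> mono_value A I \<rho> \<le> mono_value A I \<sigma>"
proof -
  define V where "V = mono_value A I ` {\<rho>. bij_betw \<rho> I J}"
  have "V \<subseteq> mono_value A I ` PiE I (\<lambda>_. J)"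
  proof
    fix x assume "x \<in> V"
    then obtain \<rho> where \<rho>: "bij_betw \<rho> I J" "x = mono_value A I \<rho>" by (auto simp: V_def)
    then have "x = mono_value A I (restrict \<rho> I)" by (simp add: mono_value_def)
    moreover have "restrict \<rho> I \<in> PiE I (\<lambda>_. J)" using \<rho>(1) by (auto simp: bij_betw_def)
    ultimately show "x \<in> mono_value A I ` PiE I (\<lambda>_. J)" by blast
  qed
  then have "finite V" using finite_PiE[of I "\<lambda>_. J"] fin by (meson finite_imageI finite_subset)
  moreover have "V \<noteq> {}" using finite_same_card_bij[OF fin card] by (auto simp: V_def)
  ultimately have "Min V \<in> V" "\<And>x. x \<in> V \<Longrightarrow> Min V \<le> x" by simp_all
  then show ?thesis using that by (auto simp: V_def)
qed

text \<open>Weak duality for the assignment problem: \<open>y\<close> and \<open>z\<close> are a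
  feasible dual solution that is tight along \<open>\<rho>\<close>.\<close>

lemma minimal_bijection_by_potentials:
  assumes \<rho>: "bij_betw \<rho> I J" and \<sigma>: "bij_betw \<sigma> I J"
    and le: "\<And>i j. i \<in> I \<Longrightarrow> j \<in> J \<Longrightarrow> y i + z j \<le> A i j"
    and eq: "\<And>i. i \<in> I \<Longrightarrow> A i (\<rho> i) = y i + z (\<rho> i)"
  shows "mono_value A I \<rho> \<le> mono_value A I \<sigma>"
proof -
  have "mono_value A I \<rho> = sum y I + (\<Sum>i\<in>I. z (\<rho> i))"
    using eq by (simp add: mono_value_def sum.distrib)
  also have "(\<Sum>i\<in>I. z (\<rho> i)) = (\<Sum>i\<in>I. z (\<sigma> i))"
    by (simp add: sum.reindex_bij_betw[OF \<rho>] sum.reindex_bij_betw[OF \<sigma>])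
  also have "sum y I + (\<Sum>i\<in>I. z (\<sigma> i)) \<le> mono_value A I \<sigma>"
    unfolding mono_value_def sum.distrib[symmetric]
    using le bij_betwE[OF \<sigma>] by (intro sum_mono) blast
  finally show ?thesis .
qed

context
  fixes I J :: "nat set" and \<rho> :: "nat \<Rightarrow> nat" and i i' :: nat
  assumes \<rho>: "bij_betw \<rho> I J" and fin: "finite I" and mem: "i \<in> I" "i' \<in> I" "i \<noteq> i'"
begin

lemma bij_betw_swap_values: "bij_betw (\<rho> \<circ> transpose i i') I J"
  using bij_betw_trans[OF permutes_imp_bij[OF permutes_swap_id] \<rho>] mem by blast

lemma mono_value_swap_values:
  "mono_value A I (\<rho> \<circ> transpose i i') =
     mono_value A I \<rho> - A i (\<rho> i) - A i' (\<rho> i') + A i (\<rho> i') + A i' (\<rho> i)"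
proof -
  have split: "sum g I = g i + g i' + sum g (I - {i} - {i'})" for g :: "nat \<Rightarrow> real"
    using fin mem sum.remove[of I i g] sum.remove[of "I - {i}" i' g] by simp
  have "(\<Sum>k\<in>I - {i} - {i'}. A k ((\<rho> \<circ> transpose i i') k)) = (\<Sum>k\<in>I - {i} - {i'}. A k (\<rho> k))"
    by (intro sum.cong) auto
  then show ?thesis
    unfolding mono_value_def split by simp
qed

text \<open>Once common factors are cancelled, the pair of \<open>i\<close> and
  \<open>\<rho> i'\<close> would have to be one of the two old pairs, which gives
  \<open>\<rho> i = \<rho> i'\<close> or \<open>i = i'\<close>. So a transposition always changes
  the monomial, although longer cycles may not.\<close>

lemma sym_monomial_swap_values: "sym_monomial I (\<rho> \<circ> transpose i i') \<noteq> sym_monomial I \<rho>"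
proof -
  let ?K = "I - {i} - {i'}"
  have m: "mset_set I = {#i, i'#} + mset_set ?K"
    using fin mem by (simp add: mset_set.remove[of I i] mset_set.remove[of "I - {i}" i'])
  have neq: "\<rho> i \<noteq> \<rho> i'" using \<rho> mem by (auto simp: bij_betw_def inj_on_def)
  have K: "image_mset (\<lambda>k. (min k ((\<rho> \<circ> transpose i i') k), max k ((\<rho> \<circ> transpose i i') k))) (mset_set ?K)
      = image_mset (\<lambda>k. (min k (\<rho> k), max k (\<rho> k))) (mset_set ?K)"
    using fin by (intro image_mset_cong) auto
  show ?thesis
  proof
    assume "sym_monomial I (\<rho> \<circ> transpose i i') = sym_monomial I \<rho>"
    then have "{#(min i (\<rho> i'), max i (\<rho> i')), (min i' (\<rho> i), max i' (\<rho> i))#}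
        = {#(min i (\<rho> i), max i (\<rho> i)), (min i' (\<rho> i'), max i' (\<rho> i'))#}"
      unfolding sym_monomial_def m image_mset_union K by (simp only: add_right_cancel) simp
    then have "(min i (\<rho> i'), max i (\<rho> i')) \<in># {#(min i (\<rho> i), max i (\<rho> i)), (min i' (\<rho> i'), max i' (\<rho> i'))#}"
      by (metis union_single_eq_member)
    then have "(min i (\<rho> i'), max i (\<rho> i')) = (min i (\<rho> i), max i (\<rho> i))
        \<or> (min i (\<rho> i'), max i (\<rho> i')) = (min i' (\<rho> i'), max i' (\<rho> i'))"
      by (simp only: set_mset_add_mset_insert set_mset_empty insert_iff empty_iff simp_thms)
    then show False
      using mem(3) neq unfolding unordered_pair_eq_iff by auto
  qed
qed

lemma sym_trop_singular_swapI:
  assumes "\<And>\<sigma>. bij_betw \<sigma> I J \<Longrightarrow> mono_value A I \<rho> \<le> mono_value A I \<sigma>"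
    and "A i (\<rho> i) + A i' (\<rho> i') = A i (\<rho> i') + A i' (\<rho> i)"
  shows "sym_trop_singular A I J"
  unfolding sym_trop_singular_def
  using \<rho> bij_betw_swap_values sym_monomial_swap_values mono_value_swap_values[of A] assms
  by (intro exI[of _ \<rho>] exI[of _ "\<rho> \<circ> transpose i i'"]) auto

end

text \<open>Two minimal bijections of the smaller submatrix, extended by the pair of
  \<open>i\<close> and \<open>\<rho> i\<close>, cost at most as much as \<open>\<rho>\<close>.
  Adding one common pair keeps their monomials distinct.\<close>

lemma sym_trop_singular_expand:
  assumes fin: "finite I" and \<rho>: "bij_betw \<rho> I J" and i: "i \<in> I"
    and min: "\<And>\<sigma>. bij_betw \<sigma> I J \<Longrightarrow> mono_value A I \<rho> \<le> mono_value A I \<sigma>"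
    and sing: "sym_trop_singular A (I - {i}) (J - {\<rho> i})"
  shows "sym_trop_singular A I J"
proof -
  let ?I = "I - {i}" and ?J = "J - {\<rho> i}"
  obtain \<sigma> \<tau> where st: "bij_betw \<sigma> ?I ?J" "bij_betw \<tau> ?I ?J"
      "sym_monomial ?I \<sigma> \<noteq> sym_monomial ?I \<tau>" "mono_value A ?I \<sigma> = mono_value A ?I \<tau>"
      "\<And>\<rho>. bij_betw \<rho> ?I ?J \<Longrightarrow> mono_value A ?I \<sigma> \<le> mono_value A ?I \<rho>"
    using sing unfolding sym_trop_singular_def by blast
  have bij: "bij_betw (\<pi>(i := \<rho> i)) I J" if "bij_betw \<pi> ?I ?J" for \<pi>
  proof -
    have "bij_betw (\<pi>(i := \<rho> i)) ?I ?J" using that by (subst bij_betw_cong[of _ _ \<pi>]) auto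
    then have "bij_betw (\<pi>(i := \<rho> i)) (?I \<union> {i}) (?J \<union> {(\<pi>(i := \<rho> i)) i})"
      by (intro notIn_Un_bij_betw) auto
    moreover have "?I \<union> {i} = I" "?J \<union> {\<rho> i} = J" using i bij_betwE[OF \<rho>] by auto
    ultimately show ?thesis by simp
  qed
  have val: "mono_value A I \<pi> = A i (\<pi> i) + mono_value A ?I \<pi>" for \<pi>
    unfolding mono_value_def using fin i by (rule sum.remove)
  have upd: "mono_value A ?I (\<pi>(i := x)) = mono_value A ?I \<pi>" for \<pi> x
    unfolding mono_value_def by (intro sum.cong) auto
  have mon: "sym_monomial I (\<pi>(i := x)) = add_mset (min i x, max i x) (sym_monomial ?I \<pi>)" for \<pi> x
  proof -
    have "image_mset (\<lambda>k. (min k ((\<pi>(i := x)) k), max k ((\<pi>(i := x)) k))) (mset_set ?I)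
        = image_mset (\<lambda>k. (min k (\<pi> k), max k (\<pi> k))) (mset_set ?I)"
      using fin by (intro image_mset_cong) auto
    then show ?thesis
      unfolding sym_monomial_def mset_set.remove[OF fin i] by simp
  qed
  have "bij_betw \<rho> ?I ?J"
    using bij_betw_DiffI[OF \<rho>, of "{i}" "{\<rho> i}"] i bij_betwE[OF \<rho>] by (auto simp: bij_betw_def)
  then have "mono_value A I (\<sigma>(i := \<rho> i)) \<le> mono_value A I \<rho>"
    using st(5)[of \<rho>] by (simp add: val upd)
  then have "mono_value A I (\<sigma>(i := \<rho> i)) \<le> mono_value A I \<pi>" if "bij_betw \<pi> I J" for \<pi>
    using min[OF that] by simp
  moreover have "mono_value A I (\<sigma>(i := \<rho> i)) = mono_value A I (\<tau>(i := \<rho> i))"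
    using st(4) by (simp add: val upd)
  moreover have "sym_monomial I (\<sigma>(i := \<rho> i)) \<noteq> sym_monomial I (\<tau>(i := \<rho> i))"
    using st(3) by (simp add: mon)
  ultimately show ?thesis
    unfolding sym_trop_singular_def using bij[OF st(1)] bij[OF st(2)] by blast
qed

section \<open>Bordering and duplicating rows and columns\<close>

definition minors_singular :: "(nat \<Rightarrow> nat \<Rightarrow> real) \<Rightarrow> nat set \<Rightarrow> nat \<Rightarrow> bool" where
  "minors_singular A S r \<longleftrightarrow>
     (\<forall>I J. I \<subseteq> S \<and> J \<subseteq> S \<and> card I = r \<and> card J = r \<longrightarrow> sym_trop_singular A I J)"

lemma minors_singularD:
  "minors_singular A S r \<Longrightarrow> I \<subseteq> S \<Longrightarrow> J \<subseteq> S \<Longrightarrow> card I = r \<Longrightarrow> card J = r \<Longrightarrow> sym_trop_singular A I J"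
  unfolding minors_singular_def by blast

text \<open>A minimal bijection cannot use row \<open>p\<close> and column \<open>p\<close> in two
  different pairs: by \<open>lt\<close>, exchanging them onto the diagonal would lower the value. So
  one pair can be removed such that only indices in \<open>S\<close> remain.\<close>

lemma minors_singular_border:
  assumes S: "finite S" "p \<notin> S" and sing: "minors_singular A S r"
    and lt: "\<And>i j. i \<in> S \<Longrightarrow> j \<in> S \<Longrightarrow> A p p + A i j < A i p + A p j"
  shows "minors_singular A (insert p S) (Suc r)"
  unfolding minors_singular_def
proof (intro allI impI, elim conjE)
  fix I J assume IJ: "I \<subseteq> insert p S" "J \<subseteq> insert p S" "card I = Suc r" "card J = Suc r"
  have fin: "finite I" "finite J" using IJ S by (meson finite_insert finite_subset)+
  obtain \<rho> where \<rho>: "bij_betw \<rho> I J"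
    and min: "\<And>\<sigma>. bij_betw \<sigma> I J \<Longrightarrow> mono_value A I \<rho> \<le> mono_value A I \<sigma>"
    by (rule exists_minimal_bijection[OF fin, of A]) (use IJ in auto)
  \<comment> \<open>If \<open>p\<close> is a row, its own pair is removed; otherwise the pair with
    column \<open>p\<close>, or any pair when \<open>p\<close> is no column either.\<close>
  have "\<exists>i\<in>I. I - {i} \<subseteq> S \<and> J - {\<rho> i} \<subseteq> S"
  proof (cases "p \<in> I")
    case True
    have "\<rho> p = p \<or> p \<notin> J"
    proof (rule ccontr)
      assume c: "\<not> (\<rho> p = p \<or> p \<notin> J)"
      then obtain i where i: "i \<in> I" "\<rho> i = p" using \<rho> by (auto simp: bij_betw_def)
      then have neq: "p \<noteq> i" using c by auto
      have "i \<in> S" "\<rho> p \<in> S" using i neq c True IJ bij_betwE[OF \<rho>] by auto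
      then show False
        using lt[of i "\<rho> p"] i min[OF bij_betw_swap_values[OF \<rho> fin(1) True i(1) neq]]
          mono_value_swap_values[OF \<rho> fin(1) True i(1) neq, of A] by simp
    qed
    then show ?thesis using True IJ by (intro bexI[of _ p]) auto
  next
    case False
    have "I \<noteq> {}" using IJ by auto
    then obtain i where i: "i \<in> I" "p \<in> J \<longrightarrow> \<rho> i = p"
      using \<rho> by (cases "p \<in> J") (auto simp: bij_betw_def)
    then show ?thesis using False IJ by (intro bexI[of _ i]) auto
  qed
  then obtain i where i: "i \<in> I" "I - {i} \<subseteq> S" "J - {\<rho> i} \<subseteq> S" by blast
  have "card (I - {i}) = r" "card (J - {\<rho> i}) = r"
    using IJ i fin bij_betwE[OF \<rho>] by auto
  then have "sym_trop_singular A (I - {i}) (J - {\<rho> i})"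
    using sing i unfolding minors_singular_def by blast
  then show "sym_trop_singular A I J"
    by (intro sym_trop_singular_expand[OF fin(1) \<rho> i(1)] min)
qed

text \<open>The monomial on the image is a function of the one on \<open>I\<close>, so distinct
  monomials come from distinct ones. Only this direction is available, as \<open>\<phi>\<close> may
  identify an element of \<open>I\<close> with one of \<open>J\<close>.\<close>

lemma sym_trop_singular_pullback:
  assumes fin: "finite I" and inj: "inj_on \<phi> I" "inj_on \<phi> J"
    and sing: "sym_trop_singular A (\<phi> ` I) (\<phi> ` J)"
  shows "sym_trop_singular (\<lambda>i j. A (\<phi> i) (\<phi> j)) I J"
proof -
  let ?A = "\<lambda>i j. A (\<phi> i) (\<phi> j)"
  obtain \<sigma> \<tau> where st: "bij_betw \<sigma> (\<phi> ` I) (\<phi> ` J)" "bij_betw \<tau> (\<phi> ` I) (\<phi> ` J)"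
      "sym_monomial (\<phi> ` I) \<sigma> \<noteq> sym_monomial (\<phi> ` I) \<tau>"
      "mono_value A (\<phi> ` I) \<sigma> = mono_value A (\<phi> ` I) \<tau>"
      "\<And>\<rho>. bij_betw \<rho> (\<phi> ` I) (\<phi> ` J) \<Longrightarrow> mono_value A (\<phi> ` I) \<sigma> \<le> mono_value A (\<phi> ` I) \<rho>"
    using sing unfolding sym_trop_singular_def by blast
  define b where "b \<pi> = inv_into J \<phi> \<circ> \<pi> \<circ> \<phi>" for \<pi>
  have I: "bij_betw \<phi> I (\<phi> ` I)" and J: "bij_betw \<phi> J (\<phi> ` J)"
    using inj by (simp_all add: bij_betw_def)
  have bij: "bij_betw (b \<pi>) I J" if "bij_betw \<pi> (\<phi> ` I) (\<phi> ` J)" for \<pi>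
    unfolding b_def using bij_betw_trans[OF I bij_betw_trans[OF that bij_betw_inv_into[OF J]]]
    by (simp add: comp_assoc)
  have \<phi>b: "\<phi> (b \<pi> i) = \<pi> (\<phi> i)" if "bij_betw \<pi> (\<phi> ` I) (\<phi> ` J)" "i \<in> I" for \<pi> i
    unfolding b_def using bij_betwE[OF that(1)] that(2) by (simp add: f_inv_into_f)
  have val: "mono_value ?A I (b \<pi>) = mono_value A (\<phi> ` I) \<pi>"
    if "bij_betw \<pi> (\<phi> ` I) (\<phi> ` J)" for \<pi>
    unfolding mono_value_def sum.reindex[OF inj(1)] using \<phi>b[OF that] by simp
  have mon: "sym_monomial (\<phi> ` I) \<pi> =
      image_mset (\<lambda>(k, l). (min (\<phi> k) (\<phi> l), max (\<phi> k) (\<phi> l))) (sym_monomial I (b \<pi>))"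
    if "bij_betw \<pi> (\<phi> ` I) (\<phi> ` J)" for \<pi>
    unfolding sym_monomial_def image_mset_mset_set[OF inj(1), symmetric] image_mset.compositionality
    using fin \<phi>b[OF that] by (intro image_mset_cong) (auto simp: min_def max_def)
  have min: "mono_value ?A I (b \<sigma>) \<le> mono_value ?A I \<rho>" if \<rho>: "bij_betw \<rho> I J" for \<rho>
  proof -
    define \<pi> where "\<pi> = \<phi> \<circ> \<rho> \<circ> inv_into I \<phi>"
    have \<pi>: "bij_betw \<pi> (\<phi> ` I) (\<phi> ` J)"
      unfolding \<pi>_def using bij_betw_trans[OF bij_betw_inv_into[OF I] bij_betw_trans[OF \<rho> J]]
      by (simp add: comp_assoc)
    have "mono_value A (\<phi> ` I) \<pi> = mono_value ?A I \<rho>"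
      unfolding mono_value_def sum.reindex[OF inj(1)] \<pi>_def using inj(1) by simp
    then show ?thesis using st(5)[OF \<pi>] val[OF st(1)] by simp
  qed
  show ?thesis
    unfolding sym_trop_singular_def
    using bij[OF st(1)] bij[OF st(2)] min st(3,4) mon[OF st(1)] mon[OF st(2)] val[OF st(1)] val[OF st(2)]
    by (intro exI[of _ "b \<sigma>"] exI[of _ "b \<tau>"]) auto
qed

text \<open>If \<open>\<phi>\<close> identifies two chosen rows or two chosen columns, exchanging
  them preserves the value of a minimal bijection; otherwise the submatrix is a relabelled one of
  \<open>A\<close>.\<close>

lemma minors_singular_duplicate:
  assumes S: "finite S" and sing: "minors_singular A (\<phi> ` S) r"
  shows "minors_singular (\<lambda>i j. A (\<phi> i) (\<phi> j)) S r"
  unfolding minors_singular_def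
proof (intro allI impI, elim conjE)
  let ?A = "\<lambda>i j. A (\<phi> i) (\<phi> j)"
  fix I J assume IJ: "I \<subseteq> S" "J \<subseteq> S" "card I = r" "card J = r"
  have fin: "finite I" "finite J" using IJ S by (meson finite_subset)+
  obtain \<rho> where \<rho>: "bij_betw \<rho> I J"
    and min: "\<And>\<sigma>. bij_betw \<sigma> I J \<Longrightarrow> mono_value ?A I \<rho> \<le> mono_value ?A I \<sigma>"
    by (rule exists_minimal_bijection[OF fin, of ?A]) (use IJ in auto)
  consider "inj_on \<phi> I" "inj_on \<phi> J" | "\<not> inj_on \<phi> I" | "\<not> inj_on \<phi> J" by blast
  then show "sym_trop_singular ?A I J"
  proof cases
    case 1
    then have "card (\<phi> ` I) = r" "card (\<phi> ` J) = r" using IJ by (simp_all add: card_image)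
    then have "sym_trop_singular A (\<phi> ` I) (\<phi> ` J)"
      by (intro minors_singularD[OF sing] image_mono IJ)
    then show ?thesis by (rule sym_trop_singular_pullback[OF fin(1) 1, of A])
  next
    case 2
    then obtain i i' where i: "i \<in> I" "i' \<in> I" "i \<noteq> i'" and eq: "\<phi> i = \<phi> i'"
      unfolding inj_on_def by blast
    show ?thesis by (rule sym_trop_singular_swapI[OF \<rho> fin(1) i, of ?A]) (auto simp: eq intro: min)
  next
    case 3
    then obtain j j' where j: "j \<in> J" "j' \<in> J" "j \<noteq> j'" and eq: "\<phi> j = \<phi> j'"
      unfolding inj_on_def by blast
    obtain i i' where i: "i \<in> I" "i' \<in> I" and \<rho>i: "\<rho> i = j" "\<rho> i' = j'"
      using \<rho> j unfolding bij_betw_def by blast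
    then have "i \<noteq> i'" using j by blast
    then show ?thesis
      by (intro sym_trop_singular_swapI[OF \<rho> fin(1) i, of ?A]) (auto simp: \<rho>i eq intro: min)
  qed
qed

section \<open>Valuations of Gram matrices of rank 3\<close>

definition upair :: "nat \<Rightarrow> nat \<Rightarrow> nat \<times> nat" where
  "upair i j = (min i j, max i j)"

lemma upair_eq_iff: "upair i j = upair k l \<longleftrightarrow> i = k \<and> j = l \<or> i = l \<and> j = k"
  unfolding upair_def by (rule unordered_pair_eq_iff)

text \<open>Here and below \<open>w\<close>, \<open>x\<close>, \<open>y\<close>, \<open>z\<close>
  stand for the values of a bijection at \<open>a\<close>, \<open>b\<close>, \<open>c\<close>,
  \<open>d\<close>. The left multiset is the monomial after composing it with a permutation of these
  rows.\<close>

lemma upair_mset_neq_transposition: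
  assumes "a \<noteq> b" "w \<noteq> x"
  shows "{#upair a x, upair b w, upair c y, upair d z#} \<noteq> {#upair a w, upair b x, upair c y, upair d z#}"
proof
  assume "{#upair a x, upair b w, upair c y, upair d z#} = {#upair a w, upair b x, upair c y, upair d z#}"
  then have "{#upair a x, upair b w#} = {#upair a w, upair b x#}"
    by (simp add: add_mset_commute)
  then have "upair a x \<in># {#upair a w, upair b x#}"
    by (metis union_single_eq_member)
  then show False using assms by (auto simp: upair_eq_iff)
qed

text \<open>The exception is a bijection that is itself a 3-cycle on \<open>a\<close>,
  \<open>b\<close>, \<open>c\<close>; the composition is then the inverse cycle.\<close>

lemma upair_mset_eq_3cycle:
  assumes "a \<noteq> b" "a \<noteq> c" "b \<noteq> c" "w \<noteq> x" "w \<noteq> y" "x \<noteq> y"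
    and eq: "{#upair a x, upair b y, upair c w, upair d z#} = {#upair a w, upair b x, upair c y, upair d z#}"
  shows "w = b \<and> x = c \<and> y = a"
proof -
  from eq have "{#upair a x, upair b y, upair c w#} = {#upair a w, upair b x, upair c y#}"
    by (simp add: add_mset_commute)
  from arg_cong[OF this, of set_mset]
  have "{upair a x, upair b y, upair c w} = {upair a w, upair b x, upair c y}" by simp
  then have "upair a x \<in> {upair a w, upair b x, upair c y}" "upair b y \<in> {upair a w, upair b x, upair c y}"
    by blast+
  then show ?thesis using assms(1-6) by (auto simp: upair_eq_iff)
qed

lemma upair_mset_4:
  assumes "{#upair a p, upair b q, upair c r, upair d s#} = {#upair a w, upair b x, upair c y, upair d z#}"
  shows "upair a p \<in> {upair a w, upair b x, upair c y, upair d z}"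
    "upair b q \<in> {upair a w, upair b x, upair c y, upair d z}"
    "upair c r \<in> {upair a w, upair b x, upair c y, upair d z}"
    "upair d s \<in> {upair a w, upair b x, upair c y, upair d z}"
proof -
  from arg_cong[OF assms, of set_mset]
  have "{upair a p, upair b q, upair c r, upair d s} = {upair a w, upair b x, upair c y, upair d z}" by simp
  then show "upair a p \<in> {upair a w, upair b x, upair c y, upair d z}"
    "upair b q \<in> {upair a w, upair b x, upair c y, upair d z}"
    "upair c r \<in> {upair a w, upair b x, upair c y, upair d z}"
    "upair d s \<in> {upair a w, upair b x, upair c y, upair d z}"
    by blast+
qed

text \<open>The two exceptions are the 4-cycles whose square is this double transposition; composing
  with it inverts them.\<close>

lemma upair_mset_eq_double_transposition:
  assumes "distinct [a, b, c, d]" "distinct [w, x, y, z]"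
    and eq: "{#upair a x, upair b w, upair c z, upair d y#} = {#upair a w, upair b x, upair c y, upair d z#}"
  shows "w = c \<and> y = b \<and> x = d \<and> z = a \<or> w = d \<and> z = b \<and> x = c \<and> y = a"
  using upair_mset_4[OF eq] assms(1,2) by (auto simp: upair_eq_iff)

text \<open>Equal monomials arise by reversing a cycle, that is by composing with its inverse
  square, an even permutation; a 4-cycle is odd.\<close>

lemma upair_mset_neq_4cycle:
  assumes "distinct [a, b, c, d]" "distinct [w, x, y, z]"
  shows "{#upair a x, upair b y, upair c z, upair d w#} \<noteq> {#upair a w, upair b x, upair c y, upair d z#}"
proof
  assume eq: "{#upair a x, upair b y, upair c z, upair d w#} = {#upair a w, upair b x, upair c y, upair d z#}"
  show False
    using upair_mset_4[OF eq] assms(1,2) by (auto simp: upair_eq_iff)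
qed

text \<open>The summands belong to the twelve even permutations: the identity, eight 3-cycles, three
  double transpositions. Each tells whether composing preserves the monomial. Four points leave room
  for just one cycle of length at least 3, so besides the identity at most one summand is 1.\<close>

lemma at_most_one_cycle_pattern:
  assumes "distinct [a, b, c, d]" "distinct [w, x, y, z]"
  shows "(1::int) + of_bool (w = b \<and> x = c \<and> y = a)
      + of_bool (w = c \<and> y = b \<and> x = a)
      + of_bool (w = b \<and> x = d \<and> z = a)
      + of_bool (w = d \<and> z = b \<and> x = a)
      + of_bool (w = c \<and> y = d \<and> z = a)
      + of_bool (w = d \<and> z = c \<and> y = a)
      + of_bool (x = c \<and> y = d \<and> z = b)
      + of_bool (x = d \<and> z = c \<and> y = b)
      + of_bool (w = c \<and> y = b \<and> x = d \<and> z = a \<or> w = d \<and> z = b \<and> x = c \<and> y = a)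
      + of_bool (w = b \<and> x = c \<and> y = d \<and> z = a \<or> w = d \<and> z = c \<and> y = b \<and> x = a)
      + of_bool (w = b \<and> x = d \<and> z = c \<and> y = a \<or> w = c \<and> y = d \<and> z = b \<and> x = a) \<in> {1, 2}"
proof -
  have d: "a \<noteq> b" "a \<noteq> c" "a \<noteq> d" "b \<noteq> c" "b \<noteq> d" "c \<noteq> d"
    "w \<noteq> x" "w \<noteq> y" "w \<noteq> z" "x \<noteq> y" "x \<noteq> z" "y \<noteq> z"
    using assms by auto
  consider "w = b" | "w = c" | "w = d" | "w \<noteq> b" "w \<noteq> c" "w \<noteq> d" by blast
  then show ?thesis
  proof cases
    case 1
    then show ?thesis using d by (cases "x = c"; cases "x = d"; cases "y = a"; cases "z = a"; simp)
  next
    case 2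
    then show ?thesis using d by (cases "y = b"; cases "y = d"; cases "x = a"; cases "z = a"; simp)
  next
    case 3
    then show ?thesis using d by (cases "z = b"; cases "z = c"; cases "x = a"; cases "y = a"; simp)
  next
    case 4
    then show ?thesis using d by (cases "x = c"; cases "x = d"; simp)
  qed
qed

text \<open>A 4 by 4 minor of a matrix of rank at most 3, written out term by term so that each term
  can be reduced separately. The even permutations come in the order of
  \<open>at_most_one_cycle_pattern\<close>, then the transpositions and the 4-cycles.\<close>

lemma gram_det4_zero:
  fixes f g h :: "nat \<Rightarrow> int"
  assumes G: "\<And>i j. G i j = f i * f j + g i * g j + h i * h j"
  shows "G a w * G b x * G c y * G d z
      + G a x * G b y * G c w * G d z
      + G a y * G c x * G b w * G d z
      + G a x * G b z * G d w * G c y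
      + G a z * G d x * G b w * G c y
      + G a y * G c z * G d w * G b x
      + G a z * G d y * G c w * G b x
      + G b y * G c z * G d x * G a w
      + G b z * G d y * G c x * G a w
      + G a x * G b w * G c z * G d y
      + G a y * G c w * G b z * G d x
      + G a z * G d w * G b y * G c x
      - G a x * G b w * G c y * G d z
      - G a y * G c w * G b x * G d z
      - G a z * G d w * G b x * G c y
      - G b y * G c x * G a w * G d z
      - G b z * G d x * G a w * G c y
      - G c z * G d y * G a w * G b x
      - G a x * G b y * G c z * G d w
      - G a x * G b z * G d y * G c w
      - G a y * G c x * G b z * G d w
      - G a y * G c z * G d x * G b w
      - G a z * G d x * G b y * G c w
      - G a z * G d y * G c x * G b w = 0"
  unfolding G by Groebner_Basis.algebra

text \<open>The coefficient of a monomial of a symmetric 4 by 4 determinant is 1, -1, 2 or -2, because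
  bijections with equal monomials differ by reversing one cycle of length 3 or 4. Modulo 3 these
  coefficients do not vanish, so the vanishing determinant has two monomials of minimal 3-adic value.\<close>
lemma sym_trop_singular_3adic_gram:
  fixes f g h :: "nat \<Rightarrow> int"
  assumes G: "\<And>i j. G i j = f i * f j + g i * g j + h i * h j"
    and pos: "\<And>i j. G i j > 0" and card: "card I = 4" "card J = 4"
  shows "sym_trop_singular (\<lambda>i j. real (multiplicity 3 (G i j))) I J"
proof (rule ccontr)
  let ?A = "\<lambda>i j. real (multiplicity 3 (G i j))"
  assume nsing: "\<not> sym_trop_singular ?A I J"
  have fin: "finite I" "finite J" using card by (auto intro: card_ge_0_finite)
  obtain \<rho> where \<rho>: "bij_betw \<rho> I J"
    and min: "\<And>\<sigma>. bij_betw \<sigma> I J \<Longrightarrow> mono_value ?A I \<rho> \<le> mono_value ?A I \<sigma>"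
    by (rule exists_minimal_bijection[OF fin, of ?A]) (use card in auto)
  have Gsym: "G i j = G j i" for i j by (simp add: G mult.commute)
  define t0 where "t0 = (\<Prod>i\<in>I. G i (\<rho> i))"
  define m where "m = (\<Sum>i\<in>I. multiplicity 3 (G i (\<rho> i)))"
  \<comment> \<open>Divisibility by \<open>D\<close> says that a term has valuation above
    \<open>m\<close>, the value of \<open>\<rho>\<close>.\<close>
  define D :: int where "D = 3 ^ Suc m"
  have p3: "prime (3::int)" by simp
  have "multiplicity 3 t0 = m"
    unfolding t0_def m_def using pos fin p3
    by (intro prime_elem_multiplicity_prod_distrib) (auto simp: less_le)
  moreover have "t0 > 0" unfolding t0_def by (intro prod_pos) (simp add: pos)
  ultimately have ndvd: "\<not> D dvd t0"
    unfolding D_def by (subst power_dvd_iff_le_multiplicity) auto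
  \<comment> \<open>The rows are listed in arbitrary order, so one claim for each cycle type covers
    all permutations of that type.\<close>
  define lst where "lst a b c d \<longleftrightarrow> I = {a, b, c, d} \<and> distinct [a, b, c, d]" for a b c d
  have inj: "inj_on \<rho> I" and img: "\<rho> ` I = J" using \<rho> by (auto simp: bij_betw_def)
  have dJ: "distinct [\<rho> a, \<rho> b, \<rho> c, \<rho> d]" if "lst a b c d" for a b c d
    using inj that by (auto simp: lst_def inj_on_def)
  \<comment> \<open>Non-singularity enters here: a bijection with another monomial has strictly
    larger value.\<close>
  have base: "D dvd G a p * G b q * G c r * G d s \<or>
      {#upair a p, upair b q, upair c r, upair d s#}
        = {#upair a (\<rho> a), upair b (\<rho> b), upair c (\<rho> c), upair d (\<rho> d)#}"
    if L: "lst a b c d" and J: "J = {p, q, r, s}" for a b c d p q r s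
  proof (rule disjCI)
    have dst: "a \<noteq> b" "a \<noteq> c" "a \<noteq> d" "b \<noteq> c" "b \<noteq> d" "c \<noteq> d" and I: "I = {a, b, c, d}"
      using L by (auto simp: lst_def)
    have sm: "(\<Sum>i\<in>I. k i) = k a + k b + k c + k d" for k :: "nat \<Rightarrow> 'b::comm_monoid_add"
      using dst by (simp add: I add.assoc)
    have mI: "mset_set I = {#a, b, c, d#}" using dst by (simp add: I)
    assume neq: "{#upair a p, upair b q, upair c r, upair d s#}
        \<noteq> {#upair a (\<rho> a), upair b (\<rho> b), upair c (\<rho> c), upair d (\<rho> d)#}"
    define \<sigma> where "\<sigma> = \<rho>(a := p, b := q, c := r, d := s)"
    have \<sigma>: "\<sigma> a = p" "\<sigma> b = q" "\<sigma> c = r" "\<sigma> d = s" using dst by (auto simp: \<sigma>_def)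
    have "\<sigma> ` I = J" using \<sigma> by (auto simp: I J)
    then have bij: "bij_betw \<sigma> I J"
      using card fin by (simp add: bij_betw_def eq_card_imp_inj_on)
    have "sym_monomial I \<sigma> \<noteq> sym_monomial I \<rho>"
      using neq \<sigma> by (simp add: sym_monomial_def mI upair_def)
    then have "mono_value ?A I \<rho> \<noteq> mono_value ?A I \<sigma>"
      using nsing bij \<rho> min unfolding sym_trop_singular_def by metis
    then have "mono_value ?A I \<rho> < mono_value ?A I \<sigma>" using min[OF bij] by simp
    then have "real m < real (\<Sum>i\<in>I. multiplicity 3 (G i (\<sigma> i)))"
      by (simp add: mono_value_def m_def)
    then have lt: "Suc m \<le> multiplicity 3 (G a p) + multiplicity 3 (G b q)
        + multiplicity 3 (G c r) + multiplicity 3 (G d s)"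
      by (simp only: sm \<sigma> of_nat_less_iff Suc_le_eq)
    then have "D dvd 3 ^ (multiplicity 3 (G a p) + multiplicity 3 (G b q)
        + multiplicity 3 (G c r) + multiplicity 3 (G d s))"
      unfolding D_def by (rule le_imp_power_dvd)
    also have "\<dots> dvd G a p * G b q * G c r * G d s"
      unfolding power_add by (intro mult_dvd_mono multiplicity_dvd)
    finally show "D dvd G a p * G b q * G c r * G d s" .
  qed
  have t0: "t0 = G a (\<rho> a) * G b (\<rho> b) * G c (\<rho> c) * G d (\<rho> d)" if "lst a b c d" for a b c d
    using that by (auto simp: t0_def lst_def mult.assoc)
  have k2: "D dvd G a (\<rho> b) * G b (\<rho> a) * G c (\<rho> c) * G d (\<rho> d)" if L: "lst a b c d" for a b c d
    using base[OF L, of "\<rho> b" "\<rho> a" "\<rho> c" "\<rho> d"] upair_mset_neq_transposition dJ[OF L] L img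
    by (auto simp: lst_def)
  have k4: "D dvd G a (\<rho> b) * G b (\<rho> c) * G c (\<rho> d) * G d (\<rho> a)" if L: "lst a b c d" for a b c d
    using base[OF L, of "\<rho> b" "\<rho> c" "\<rho> d" "\<rho> a"] upair_mset_neq_4cycle[OF _ dJ[OF L], of a b c d] L img
    by (auto simp: lst_def)
  have k3: "D dvd G a (\<rho> b) * G b (\<rho> c) * G c (\<rho> a) * G d (\<rho> d)
      - of_bool (\<rho> a = b \<and> \<rho> b = c \<and> \<rho> c = a) * t0" if L: "lst a b c d" for a b c d
  proof (cases "\<rho> a = b \<and> \<rho> b = c \<and> \<rho> c = a")
    case True
    then show ?thesis by (simp add: t0[OF L] Gsym[of a c] Gsym[of b a] Gsym[of c b])
  next
    case False
    have "J = {\<rho> b, \<rho> c, \<rho> a, \<rho> d}" using L img by (auto simp: lst_def)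
    then have "D dvd G a (\<rho> b) * G b (\<rho> c) * G c (\<rho> a) * G d (\<rho> d)"
      using base[OF L, of "\<rho> b" "\<rho> c" "\<rho> a" "\<rho> d"] dJ[OF L] L False
        upair_mset_eq_3cycle[of a b c "\<rho> a" "\<rho> b" "\<rho> c" d "\<rho> d"]
      unfolding lst_def distinct.simps by auto
    then show ?thesis using False by auto
  qed
  have k22: "D dvd G a (\<rho> b) * G b (\<rho> a) * G c (\<rho> d) * G d (\<rho> c)
      - of_bool (\<rho> a = c \<and> \<rho> c = b \<and> \<rho> b = d \<and> \<rho> d = a \<or> \<rho> a = d \<and> \<rho> d = b \<and> \<rho> b = c \<and> \<rho> c = a) * t0"
    if L: "lst a b c d" for a b c d
  proof (cases "\<rho> a = c \<and> \<rho> c = b \<and> \<rho> b = d \<and> \<rho> d = a \<or> \<rho> a = d \<and> \<rho> d = b \<and> \<rho> b = c \<and> \<rho> c = a")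
    case True
    then have "G a (\<rho> b) * G b (\<rho> a) * G c (\<rho> d) * G d (\<rho> c) = t0"
      using Gsym[of a c] Gsym[of a d] Gsym[of b c] Gsym[of b d] by (auto simp: t0[OF L])
    then show ?thesis using True by (simp only: of_bool_eq simp_thms) simp
  next
    case False
    have "J = {\<rho> b, \<rho> a, \<rho> d, \<rho> c}" using L img by (auto simp: lst_def)
    then have "D dvd G a (\<rho> b) * G b (\<rho> a) * G c (\<rho> d) * G d (\<rho> c)"
      using base[OF L] upair_mset_eq_double_transposition[OF _ dJ[OF L], of a b c d] L False
      unfolding lst_def by blast
    then show ?thesis using False by (simp only: of_bool_eq simp_thms) simp
  qed
  note c2 = k2[unfolded cong_0_iff[symmetric]] and c4 = k4[unfolded cong_0_iff[symmetric]]
    and c3 = k3[unfolded cong_iff_dvd_diff[symmetric]] and c22 = k22[unfolded cong_iff_dvd_diff[symmetric]]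
  obtain as where as: "set as = I" "distinct as" "length as = 4"
    using finite_distinct_list[OF fin(1)] card distinct_card by metis
  then obtain a b c d where "as = [a, b, c, d]"
    by (auto simp: numeral_eq_Suc length_Suc_conv)
  then have L: "lst a b c d"
    "lst a c b d"
    "lst a d b c"
    "lst b c a d"
    "lst b d a c"
    "lst c d a b"
    "lst a b d c"
    "lst a c d b"
    "lst a d c b"
    "lst b c d a"
    "lst b d c a"
    using as by (auto simp: lst_def)
  let ?n = "(1::int) + of_bool (\<rho> a = b \<and> \<rho> b = c \<and> \<rho> c = a)
      + of_bool (\<rho> a = c \<and> \<rho> c = b \<and> \<rho> b = a)
      + of_bool (\<rho> a = b \<and> \<rho> b = d \<and> \<rho> d = a)
      + of_bool (\<rho> a = d \<and> \<rho> d = b \<and> \<rho> b = a)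
      + of_bool (\<rho> a = c \<and> \<rho> c = d \<and> \<rho> d = a)
      + of_bool (\<rho> a = d \<and> \<rho> d = c \<and> \<rho> c = a)
      + of_bool (\<rho> b = c \<and> \<rho> c = d \<and> \<rho> d = b)
      + of_bool (\<rho> b = d \<and> \<rho> d = c \<and> \<rho> c = b)
      + of_bool (\<rho> a = c \<and> \<rho> c = b \<and> \<rho> b = d \<and> \<rho> d = a \<or> \<rho> a = d \<and> \<rho> d = b \<and> \<rho> b = c \<and> \<rho> c = a)
      + of_bool (\<rho> a = b \<and> \<rho> b = c \<and> \<rho> c = d \<and> \<rho> d = a \<or> \<rho> a = d \<and> \<rho> d = c \<and> \<rho> c = b \<and> \<rho> b = a)
      + of_bool (\<rho> a = b \<and> \<rho> b = d \<and> \<rho> d = c \<and> \<rho> c = a \<or> \<rho> a = c \<and> \<rho> c = d \<and> \<rho> d = b \<and> \<rho> b = a)"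
  have "?n \<in> {1, 2}"
    using L(1) dJ[OF L(1)] unfolding lst_def by (intro at_most_one_cycle_pattern) auto
  then have "?n = 1 \<or> ?n = 2" by blast
  moreover have "D dvd ?n * t0"
  proof -
    \<comment> \<open>Modulo \<open>D\<close> each even term is \<open>t0\<close> or 0 according to
      its cycle pattern, and the odd terms vanish.\<close>
    have "[t0
      + G a (\<rho> b) * G b (\<rho> c) * G c (\<rho> a) * G d (\<rho> d)
      + G a (\<rho> c) * G c (\<rho> b) * G b (\<rho> a) * G d (\<rho> d)
      + G a (\<rho> b) * G b (\<rho> d) * G d (\<rho> a) * G c (\<rho> c)
      + G a (\<rho> d) * G d (\<rho> b) * G b (\<rho> a) * G c (\<rho> c)
      + G a (\<rho> c) * G c (\<rho> d) * G d (\<rho> a) * G b (\<rho> b)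
      + G a (\<rho> d) * G d (\<rho> c) * G c (\<rho> a) * G b (\<rho> b)
      + G b (\<rho> c) * G c (\<rho> d) * G d (\<rho> b) * G a (\<rho> a)
      + G b (\<rho> d) * G d (\<rho> c) * G c (\<rho> b) * G a (\<rho> a)
      + G a (\<rho> b) * G b (\<rho> a) * G c (\<rho> d) * G d (\<rho> c)
      + G a (\<rho> c) * G c (\<rho> a) * G b (\<rho> d) * G d (\<rho> b)
      + G a (\<rho> d) * G d (\<rho> a) * G b (\<rho> c) * G c (\<rho> b)
      - G a (\<rho> b) * G b (\<rho> a) * G c (\<rho> c) * G d (\<rho> d)
      - G a (\<rho> c) * G c (\<rho> a) * G b (\<rho> b) * G d (\<rho> d)
      - G a (\<rho> d) * G d (\<rho> a) * G b (\<rho> b) * G c (\<rho> c)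
      - G b (\<rho> c) * G c (\<rho> b) * G a (\<rho> a) * G d (\<rho> d)
      - G b (\<rho> d) * G d (\<rho> b) * G a (\<rho> a) * G c (\<rho> c)
      - G c (\<rho> d) * G d (\<rho> c) * G a (\<rho> a) * G b (\<rho> b)
      - G a (\<rho> b) * G b (\<rho> c) * G c (\<rho> d) * G d (\<rho> a)
      - G a (\<rho> b) * G b (\<rho> d) * G d (\<rho> c) * G c (\<rho> a)
      - G a (\<rho> c) * G c (\<rho> b) * G b (\<rho> d) * G d (\<rho> a)
      - G a (\<rho> c) * G c (\<rho> d) * G d (\<rho> b) * G b (\<rho> a)
      - G a (\<rho> d) * G d (\<rho> b) * G b (\<rho> c) * G c (\<rho> a)
      - G a (\<rho> d) * G d (\<rho> c) * G c (\<rho> b) * G b (\<rho> a) = t0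
      + of_bool (\<rho> a = b \<and> \<rho> b = c \<and> \<rho> c = a) * t0
      + of_bool (\<rho> a = c \<and> \<rho> c = b \<and> \<rho> b = a) * t0
      + of_bool (\<rho> a = b \<and> \<rho> b = d \<and> \<rho> d = a) * t0
      + of_bool (\<rho> a = d \<and> \<rho> d = b \<and> \<rho> b = a) * t0
      + of_bool (\<rho> a = c \<and> \<rho> c = d \<and> \<rho> d = a) * t0
      + of_bool (\<rho> a = d \<and> \<rho> d = c \<and> \<rho> c = a) * t0
      + of_bool (\<rho> b = c \<and> \<rho> c = d \<and> \<rho> d = b) * t0
      + of_bool (\<rho> b = d \<and> \<rho> d = c \<and> \<rho> c = b) * t0
      + of_bool (\<rho> a = c \<and> \<rho> c = b \<and> \<rho> b = d \<and> \<rho> d = a \<or> \<rho> a = d \<and> \<rho> d = b \<and> \<rho> b = c \<and> \<rho> c = a) * t0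
      + of_bool (\<rho> a = b \<and> \<rho> b = c \<and> \<rho> c = d \<and> \<rho> d = a \<or> \<rho> a = d \<and> \<rho> d = c \<and> \<rho> c = b \<and> \<rho> b = a) * t0
      + of_bool (\<rho> a = b \<and> \<rho> b = d \<and> \<rho> d = c \<and> \<rho> c = a \<or> \<rho> a = c \<and> \<rho> c = d \<and> \<rho> d = b \<and> \<rho> b = a) * t0
      - 0 - 0 - 0 - 0 - 0 - 0 - 0 - 0 - 0 - 0 - 0 - 0] (mod D)"
      by (intro cong_add cong_diff cong_refl c2 c3 c4 c22 L)
    then have "[0 = ?n * t0] (mod D)"
      using gram_det4_zero[of G f g h a "\<rho> a" b "\<rho> b" c "\<rho> c" d "\<rho> d", OF G]
      unfolding distrib_right mult_1_left t0[OF L(1), symmetric] by (simp only: diff_zero)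
    then show ?thesis by (simp only: cong_0_iff cong_sym_eq[of 0])
  qed
  ultimately have "D dvd t0 \<or> D dvd 2 * t0" by (elim disjE) (simp_all only: mult_1_left simp_thms)
  \<comment> \<open>A merged coefficient 2 is harmless because \<open>D\<close> is a power of
    3.\<close>
  moreover have "coprime D 2" by (simp add: D_def)
  ultimately show False using ndvd by (simp add: coprime_dvd_mult_right_iff)
qed

section \<open>Minors over Hahn series as determinants\<close>

lemma hcoeff_sum: "hcoeff (\<Sum>x\<in>A. f x) g = (\<Sum>x\<in>A. hcoeff (f x) g)"
  by (induction A rule: infinite_finite_induct) simp_all

lemma hcoeff_sign_times: "hcoeff (of_int (sign p) * f) g = of_int (sign p) * hcoeff f g"
  by (cases p rule: sign_cases) simp_all

lemma det_mat_eq_sum_permutations: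
  "det (mat r r (\<lambda>(i, j). f i j)) = (\<Sum>p | p permutes {..<r}. of_int (sign p) * (\<Prod>k<r. f k (p k)))"
proof -
  have "(\<Prod>k<r. mat r r (\<lambda>(i, j). f i j) $$ (k, p k)) = (\<Prod>k<r. f k (p k))" if "p permutes {..<r}" for p
    using permutes_in_image[OF that] by (intro prod.cong) auto
  then show ?thesis
    by (subst det_def'[of _ r]) (auto simp: atLeast0LessThan intro!: sum.cong)
qed

lemma hahn_minor_eq_det:
  assumes "\<And>k l. k < r \<Longrightarrow> l < r \<Longrightarrow> is_hahn (M (u k) (v l))"
  shows "hahn_minor M r u v g = hcoeff (det (mat r r (\<lambda>(i, j). Abs_hahn (M (u i) (v j))))) g"
proof -
  have "hahn_prod {..<r} (\<lambda>k. M (u k) (v (p k))) g = hcoeff (\<Prod>k<r. Abs_hahn (M (u k) (v (p k)))) g"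
    if "p permutes {..<r}" for p
    using permutes_in_image[OF that] by (intro hahn_prod_eq_hcoeff_prod) (auto intro!: assms)
  then show ?thesis
    unfolding hahn_minor_def det_mat_eq_sum_permutations hcoeff_sum hcoeff_sign_times
    by (intro sum.cong) auto
qed

text \<open>On series without negative exponents, taking the constant coefficient is a ring
  homomorphism; this is \<open>hahn_prod_lowest\<close> with all bounds 0.\<close>

lemma hahn_minor_0_eq_det:
  assumes "\<And>k l a. k < r \<Longrightarrow> l < r \<Longrightarrow> a < 0 \<Longrightarrow> M (u k) (v l) a = 0"
  shows "hahn_minor M r u v 0 = det (mat r r (\<lambda>(i, j). M (u i) (v j) 0))"
proof -
  have "hahn_prod {..<r} (\<lambda>k. M (u k) (v (p k))) 0 = (\<Prod>k<r. M (u k) (v (p k)) 0)"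
    if "p permutes {..<r}" for p
    using hahn_prod_lowest[of "{..<r}" "\<lambda>_. 0" "\<lambda>k. M (u k) (v (p k))"] permutes_in_image[OF that] assms
    by simp
  then show ?thesis
    unfolding hahn_minor_def det_mat_eq_sum_permutations by (intro sum.cong) auto
qed

section \<open>The projective plane of order 3\<close>

text \<open>Representatives with positive coordinates of the 13 points of the projective plane over the
  field with three elements; the coordinate 0 is written as 3.\<close>

definition pg_x :: "nat \<Rightarrow> int" where
  "pg_x i = (if i < 13 then [1, 3, 3, 1, 1, 3, 1, 1, 3, 1, 2, 1, 1] ! i else 1)"
definition pg_y :: "nat \<Rightarrow> int" where
  "pg_y i = (if i < 13 then [3, 1, 3, 1, 3, 1, 2, 3, 1, 1, 1, 2, 1] ! i else 1)"
definition pg_z :: "nat \<Rightarrow> int" where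
  "pg_z i = (if i < 13 then [3, 3, 1, 3, 1, 1, 3, 2, 2, 1, 1, 1, 2] ! i else 1)"

text \<open>Modulo 3, point \<open>i\<close> lies on the polar line of point \<open>j\<close>
  exactly when this vanishes. Writing 0 as 3 and continuing by 1 beyond the 13 points keeps all
  values positive, so multiplicities are genuine valuations, and the rank is at most 3 for every
  matrix size.\<close>

definition pg_dot :: "nat \<Rightarrow> nat \<Rightarrow> int" where
  "pg_dot i j = pg_x i * pg_x j + pg_y i * pg_y j + pg_z i * pg_z j"

lemma pg_dot_pos: "pg_dot i j > 0"
proof -
  have "pg_x k > 0 \<and> pg_y k > 0 \<and> pg_z k > 0" for k
    by (cases "k < 13") (auto simp: pg_x_def pg_y_def pg_z_def eval_nat_numeral less_Suc_eq)
  then show ?thesis unfolding pg_dot_def by (simp add: add_pos_pos)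
qed

text \<open>With an invertible diagonal leading block, three pivots on the diagonal leave the zero
  matrix. Dividing out the pivots expresses \<open>c i j\<close> as a pairing of three coordinates
  of row \<open>i\<close> with three of column \<open>j\<close>.\<close>

lemma diagonal_pivots3:
  fixes c :: "nat \<Rightarrow> nat \<Rightarrow> 'a::field"
  assumes van: "minors_vanish S S c 4" and S: "0 \<in> S" "1 \<in> S" "2 \<in> S" "i \<in> S" "j \<in> S"
    and nz: "c 0 0 \<noteq> 0" "c 1 1 \<noteq> 0" "c 2 2 \<noteq> 0"
    and z: "c 0 1 = 0" "c 0 2 = 0" "c 1 0 = 0" "c 1 2 = 0" "c 2 0 = 0" "c 2 1 = 0"
  shows "c i j = c i 0 * (c 0 j / c 0 0) + c i 1 * (c 1 j / c 1 1) + c i 2 * (c 2 j / c 2 2)"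
proof -
  define M1 where "M1 = pivot 0 0 c"
  define M2 where "M2 = pivot 1 1 M1"
  have M1: "M1 k l = c 0 0 * c k l - c k 0 * c 0 l" for k l by (simp add: M1_def pivot_def)
  have M2: "M2 k l = c 0 0 * c 1 1 * (c 0 0 * c k l - c k 0 * c 0 l) - c 0 0 * c k 1 * (c 0 0 * c 1 l)" for k l
    unfolding M2_def pivot_def M1 z by simp
  have M2_2: "M2 2 2 = c 0 0 * c 1 1 * (c 0 0 * c 2 2)" "M2 i 2 = c 0 0 * c 1 1 * (c 0 0 * c i 2)"
    "M2 2 j = c 0 0 * c 1 1 * (c 0 0 * c 2 j)"
    unfolding M2 z by simp_all
  have "minors_vanish S S c (Suc 3)" using van by simp
  then have "minors_vanish S S M1 3" unfolding M1_def using S nz by (intro minors_vanish_pivot)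
  then have "minors_vanish S S M1 (Suc 2)" by simp
  then have "minors_vanish S S M2 2"
    unfolding M2_def by (rule minors_vanish_pivot) (use S nz z in \<open>simp_all add: M1\<close>)
  then have "minors_vanish S S M2 (Suc 1)" by (simp add: numeral_2_eq_2)
  then have "minors_vanish S S (pivot 2 2 M2) 1"
    by (rule minors_vanish_pivot) (use S nz in \<open>simp_all add: M2_2\<close>)
  then have "pivot 2 2 M2 i j = 0" using S by (intro minors_vanish_1D)
  moreover have "pivot 2 2 M2 i j = c 0 0 ^ 3 * c 1 1 * (c 0 0 * c 1 1 * c 2 2 * c i j - (c i 0 * c 0 j * c 1 1 * c 2 2
      + c i 1 * c 1 j * c 0 0 * c 2 2 + c i 2 * c 2 j * c 0 0 * c 1 1))"
    unfolding pivot_def M2_2 unfolding M2 by (simp add: algebra_simps power3_eq_cube)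
  ultimately have "c 0 0 ^ 3 * c 1 1 * (c 0 0 * c 1 1 * c 2 2 * c i j - (c i 0 * c 0 j * c 1 1 * c 2 2
      + c i 1 * c 1 j * c 0 0 * c 2 2 + c i 2 * c 2 j * c 0 0 * c 1 1)) = 0" by (simp only:)
  then have "c 0 0 * c 1 1 * c 2 2 * c i j = c i 0 * c 0 j * c 1 1 * c 2 2
      + c i 1 * c 1 j * c 0 0 * c 2 2 + c i 2 * c 2 j * c 0 0 * c 1 1"
    using nz by simp
  then show ?thesis using nz by (simp add: field_simps)
qed

text \<open>Two vectors of the plane orthogonal to the same nonzero vector are parallel. It is
  applied to points and lines whose incidence involves only two coordinates.\<close>

lemma linear_dependence2:
  fixes u v :: "'a::field"
  assumes "u * q + v * q' = 0" "u' * q + v' * q' = 0" "q \<noteq> 0"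
  shows "u * v' = u' * v"
proof -
  have "(u * v' - u' * v) * q = v' * (u * q + v * q') - v * (u' * q + v' * q')"
    by (simp add: algebra_simps)
  then show ?thesis using assms by simp
qed

lemma linear_relation_proportional:
  fixes u v :: "'a::field"
  assumes "u * q + v * q' = 0" "u * w' = w * v" "u \<noteq> 0"
  shows "w * q + w' * q' = 0"
proof -
  have "u * (w * q + w' * q') = w * (u * q + v * q') + (u * w' - w * v) * q'"
    by (simp add: algebra_simps)
  then show ?thesis using assms by simp
qed

text \<open>In coordinates where the first three points are the unit vectors and point 9 has coordinates
  (1,1,1), the incidences force line 9 to have coordinates (1,1,1) as well; as point 9 lies on line 9,
  the characteristic is 3.\<close>
lemma no_char_0_projective_plane_of_order_3:
  fixes c :: "nat \<Rightarrow> nat \<Rightarrow> 'a::field_char_0"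
  assumes van: "minors_vanish {..<13} {..<13} c 4"
    and zero: "\<And>i j. i < 13 \<Longrightarrow> j < 13 \<Longrightarrow> c i j = 0 \<longleftrightarrow> 3 dvd pg_dot i j"
  shows False
proof -
  note pg = pg_dot_def pg_x_def pg_y_def pg_z_def
  \<comment> \<open>Point \<open>i\<close> has the coordinates \<open>c i 0\<close>,
    \<open>c i 1\<close>, \<open>c i 2\<close> and line \<open>j\<close> the coordinates
    \<open>q 0 j\<close>, \<open>q 1 j\<close>, \<open>q 2 j\<close>; by
    \<open>diagonal_pivots3\<close> their pairing is \<open>c i j\<close>.\<close>
  define q where "q k j = c k j / c k k" for k j
  have nz: "c 0 0 \<noteq> 0" "c 1 1 \<noteq> 0" "c 2 2 \<noteq> 0" by (simp_all add: zero pg)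
  have z: "c 0 1 = 0" "c 0 2 = 0" "c 1 0 = 0" "c 1 2 = 0" "c 2 0 = 0" "c 2 1 = 0"
    by (simp_all add: zero pg)
  have rel: "c i j = c i 0 * q 0 j + c i 1 * q 1 j + c i 2 * q 2 j" if "i < 13" "j < 13" for i j
    unfolding q_def by (rule diagonal_pivots3[OF van]) (use that nz z in auto)
  have q0: "q k j = 0 \<longleftrightarrow> 3 dvd pg_dot k j" if "k < 3" "j < 13" for k j
  proof -
    have "k = 0 \<or> k = 1 \<or> k = 2" using that by auto
    then show ?thesis using nz zero[of k j] that by (auto simp: q_def)
  qed
  have inc: "c i 0 * q 0 j + c i 1 * q 1 j + c i 2 * q 2 j = 0"
    if "i < 13" "j < 13" "3 dvd pg_dot i j" for i j
    using rel[of i j] zero[of i j] that by simp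
  have w: "c 9 0 \<noteq> 0" "c 9 1 \<noteq> 0" "c 9 2 \<noteq> 0" by (simp_all add: zero pg)
  have pz: "c 3 2 = 0" "c 4 1 = 0" "c 5 0 = 0" "c 6 2 = 0" "c 7 1 = 0" "c 8 0 = 0"
    by (simp_all add: zero pg)
  have pnz: "c 3 0 \<noteq> 0" "c 3 1 \<noteq> 0" "c 4 0 \<noteq> 0" "c 4 2 \<noteq> 0" "c 5 1 \<noteq> 0" "c 5 2 \<noteq> 0" "c 6 0 \<noteq> 0" "c 7 0 \<noteq> 0"
    by (simp_all add: zero pg)
  have qz: "q 2 6 = 0" "q 1 7 = 0" "q 0 8 = 0" by (simp_all add: q0 pg)
  have qnz: "q 0 6 \<noteq> 0" "q 0 7 \<noteq> 0" "q 1 8 \<noteq> 0" "q 2 12 \<noteq> 0" "q 0 12 \<noteq> 0" "q 0 11 \<noteq> 0" "q 0 9 \<noteq> 0"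
    by (simp_all add: q0 pg)
  have inc2: "c 3 0 * q 0 6 + c 3 1 * q 1 6 = 0" "c 9 0 * q 0 6 + c 9 1 * q 1 6 = 0"
    "c 4 0 * q 0 7 + c 4 2 * q 2 7 = 0" "c 9 0 * q 0 7 + c 9 2 * q 2 7 = 0"
    "c 5 1 * q 1 8 + c 5 2 * q 2 8 = 0" "c 9 1 * q 1 8 + c 9 2 * q 2 8 = 0"
    using inc[of 3 6] inc[of 9 6] inc[of 4 7] inc[of 9 7] inc[of 5 8] inc[of 9 8]
    by (simp_all only: qz pz mult_zero_right mult_zero_left add_0_left add_0_right) (simp_all add: pg)
  have inc3: "c 4 0 * q 0 12 + c 4 2 * q 2 12 = 0" "c 5 1 * q 1 12 + c 5 2 * q 2 12 = 0"
    "c 6 0 * q 0 12 + c 6 1 * q 1 12 = 0" "c 3 0 * q 0 11 + c 3 1 * q 1 11 = 0"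
    "c 5 1 * q 1 11 + c 5 2 * q 2 11 = 0" "c 7 0 * q 0 11 + c 7 2 * q 2 11 = 0"
    "c 6 0 * q 0 9 + c 6 1 * q 1 9 = 0" "c 7 0 * q 0 9 + c 7 2 * q 2 9 = 0"
    using inc[of 4 12] inc[of 5 12] inc[of 6 12] inc[of 3 11] inc[of 5 11] inc[of 7 11] inc[of 6 9] inc[of 7 9]
    by (simp_all only: pz mult_zero_left add_0_left add_0_right) (simp_all add: pg)
  have inc9: "c 9 0 * q 0 9 + c 9 1 * q 1 9 + c 9 2 * q 2 9 = 0"
    by (rule inc) (simp_all add: pg)
  have p3: "c 3 0 * c 9 1 = c 9 0 * c 3 1" by (rule linear_dependence2[OF inc2(1,2) qnz(1)])
  have p4: "c 4 0 * c 9 2 = c 9 0 * c 4 2" by (rule linear_dependence2[OF inc2(3,4) qnz(2)])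
  have p5: "c 5 1 * c 9 2 = c 9 1 * c 5 2" by (rule linear_dependence2[OF inc2(5,6) qnz(3)])
  have cancel: "x + - y * z' = 0" if "x + t = 0" "y * z' + t = 0" for x y z' t :: 'a
    using that by (metis add.right_cancel mult_minus_left add.right_inverse)
  have p6: "c 6 0 * - c 9 1 = c 9 0 * c 6 1"
    by (rule linear_dependence2[OF inc3(3) cancel[OF
          linear_relation_proportional[OF inc3(1) p4 pnz(3)]
          linear_relation_proportional[OF inc3(2) p5 pnz(5)]] qnz(5)])
  have "c 9 2 * q 2 11 + c 9 1 * q 1 11 = 0"
    using linear_relation_proportional[OF inc3(5) p5 pnz(5)] by (simp only: add.commute)
  then have p7: "c 7 0 * - c 9 2 = c 9 0 * c 7 2"
    by (rule linear_dependence2[OF inc3(6) cancel[OF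
          linear_relation_proportional[OF inc3(4) p3 pnz(1)]] qnz(6)])
  have "c 9 0 * q 0 9 + - c 9 1 * q 1 9 = 0" "c 9 0 * q 0 9 + - c 9 2 * q 2 9 = 0"
    using linear_relation_proportional[OF inc3(7) p6 pnz(7)] linear_relation_proportional[OF inc3(8) p7 pnz(8)]
    by simp_all
  then have "c 9 1 * q 1 9 = c 9 0 * q 0 9" "c 9 2 * q 2 9 = c 9 0 * q 0 9"
    by (simp_all only: mult_minus_left add_uminus_conv_diff right_minus_eq)
  with inc9 have "c 9 0 * q 0 9 + c 9 0 * q 0 9 + c 9 0 * q 0 9 = 0" by (simp only:)
  then have "3 * (c 9 0 * q 0 9) = 0" by simp
  then show False using w qnz by simp
qed

lemma not_tropical_basis_4:
  assumes "12 < n"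
  shows "\<not> sym_minors_tropical_basis n 4"
proof
  assume basis: "sym_minors_tropical_basis n 4"
  define A where "A i j = real (multiplicity 3 (pg_dot i j))" for i j
  have "sym_trop_singular A I J" if "card I = 4" "card J = 4" for I J
    using sym_trop_singular_3adic_gram[OF pg_dot_def pg_dot_pos that] by (simp add: A_def[abs_def])
  moreover have "sym_real_mat n A"
    by (simp add: sym_real_mat_def A_def pg_dot_def mult.commute)
  ultimately obtain M where lift: "symmetric_lift n A M" and rank: "hahn_rank_lt n M 4"
    using basis unfolding sym_minors_tropical_basis_def by blast
  \<comment> \<open>All valuations are nonnegative, so constant coefficients respect determinants;
    they vanish exactly where the valuation is positive, that is at incidences.\<close>
  define c where "c i j = M i j 0" for i j
  have val: "has_val (Abs_hahn (M i j)) (A i j)" and hahn: "is_hahn (M i j)" if "i < n" "j < n" for i j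
    using lift that has_val_hahn_deg[of "M i j"] unfolding symmetric_lift_def by metis+
  have low: "M i j a = 0" if "i < n" "j < n" "a < A i j" for i j a
    using val[OF that(1,2)] hahn[OF that(1,2)] that(3) by (simp add: has_val_def val_ge_def hcoeff_Abs_hahn)
  have lead: "M i j (A i j) \<noteq> 0" if "i < n" "j < n" for i j
    using val[OF that] hahn[OF that] by (simp add: has_val_def hcoeff_Abs_hahn)
  have "minors_vanish {..<13} {..<13} c 4"
    unfolding minors_vanish_def
  proof (intro allI impI)
    fix u v assume uv: "\<forall>k<(4::nat). u k \<in> {..<13::nat} \<and> v k \<in> {..<13::nat}"
    then have lt: "u k < n \<and> v k < n" if "k < 4" for k using that assms by fastforce
    then have "hahn_minor M 4 u v 0 = 0" using rank unfolding hahn_rank_lt_def by blast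
    moreover have "hahn_minor M 4 u v 0 = det (mat 4 4 (\<lambda>(i, j). M (u i) (v j) 0))"
      using lt by (intro hahn_minor_0_eq_det low) (auto simp: A_def intro: less_le_trans)
    ultimately show "det (mat 4 4 (\<lambda>(i, j). c (u i) (v j))) = 0" by (simp add: c_def)
  qed
  moreover have "c i j = 0 \<longleftrightarrow> 3 dvd pg_dot i j" if "i < 13" "j < 13" for i j
  proof -
    have ij: "i < n" "j < n" using that assms by auto
    have "3 dvd pg_dot i j \<longleftrightarrow> multiplicity 3 (pg_dot i j) > 0"
      using pg_dot_pos[of i j] by (subst prime_multiplicity_gt_zero_iff) auto
    also have "\<dots> \<longleftrightarrow> A i j > 0" by (simp add: A_def)
    also have "\<dots> \<longleftrightarrow> c i j = 0"
      using low[OF ij, of 0] lead[OF ij] by (cases "A i j = 0") (auto simp: c_def A_def)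
    finally show ?thesis by simp
  qed
  ultimately show False by (rule no_char_0_projective_plane_of_order_3)
qed

section \<open>Shitov matrices\<close>

text \<open>A symmetric variant of Shitov's 6 by 6 matrix of tropical rank 4 and Kapranov rank 5, continued
  outside the 6 by 6 corner by 0 on the diagonal and 3 elsewhere. Row \<open>i\<close> of the corner
  meets a block of zeros in column \<open>zero_partner i\<close>.\<close>

definition shitov :: "nat \<Rightarrow> nat \<Rightarrow> int" where
  "shitov i j = (if i < 6 \<and> j < 6 then
      [[0, 0, 3, 3, 3, 3],
       [0, 0, 3, 1, 3, 1],
       [3, 3, 3, 3, 0, 0],
       [3, 1, 3, 1, 0, 0],
       [3, 3, 0, 0, 3, 3],
       [3, 1, 0, 0, 3, 2]] ! i ! j
     else if i = j then 0 else 3)"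

text \<open>On the indices below 6 this is an involution, so it leads from columns back to rows as
  well.\<close>

definition zero_partner :: "nat \<Rightarrow> nat" where
  "zero_partner i = (if i < 2 then i else if i < 4 then i + 2 else i - 2)"

section \<open>Singularity of the 5 by 5 submatrices\<close>

lemma less_6_cases: "i < 6 \<Longrightarrow> i \<in> set [0, 1, 2, 3, 4, 5::nat]"
  by (simp add: eval_nat_numeral less_Suc_eq)

lemma shitov_le_3: "shitov i j \<le> 3"
proof (cases "i < 6 \<and> j < 6")
  case True
  have "\<forall>i\<in>set [0, 1, 2, 3, 4, 5]. \<forall>j\<in>set [0, 1, 2, 3, 4, 5]. shitov i j \<le> 3" by code_simp
  then show ?thesis using True less_6_cases by blast
qed (auto simp: shitov_def)

lemma shitov_sym: "shitov i j = shitov j i"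
proof (cases "i < 6 \<and> j < 6")
  case True
  have "\<forall>i\<in>set [0, 1, 2, 3, 4, 5]. \<forall>j\<in>set [0, 1, 2, 3, 4, 5]. shitov i j = shitov j i" by code_simp
  then show ?thesis using True less_6_cases by blast
qed (auto simp: shitov_def)

text \<open>Deleting row \<open>x\<close> and column \<open>y\<close> leaves a block of zeros untouched. A bijection of minimal value
  uses this whole block, so exchanging its two values gives another monomial. The value of the
  bijection is 0 if \<open>x\<close> and \<open>y\<close> hit the same block of zeros and otherwise the least entry
  of the 2 by 2 block formed by the surplus rows and columns; minimality is witnessed by potentials constant on blocks.\<close>

definition cert_bij :: "nat \<Rightarrow> nat \<Rightarrow> nat \<Rightarrow> nat" where
  "cert_bij x y i =
     (let X = x div 2; Y = zero_partner y div 2; y' = (if even y then y + 1 else y - 1) in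
      if i div 2 \<noteq> X \<and> i div 2 \<noteq> Y then zero_partner i
      else if X = Y then y'
      else if i div 2 = X then zero_partner (2 * X)
      else if odd i then zero_partner (2 * X + 1) else y')"

text \<open>Dual variables: row \<open>i\<close> carries \<open>cert_pot x y i\<close> and column
  \<open>j\<close> the negative of the value at \<open>zero_partner j\<close>, so blocks of zeros
  are tight. For \<open>X \<noteq> Y\<close>, \<open>b\<close> is the least entry of the surplus
  block, and \<open>b - 1\<close> suits the untouched block because entries linking different blocks
  are at least 1.\<close>

definition cert_pot :: "nat \<Rightarrow> nat \<Rightarrow> nat \<Rightarrow> int" where
  "cert_pot x y i =
     (let X = x div 2; Y = zero_partner y div 2; b = shitov (2 * Y + 1) (zero_partner (2 * X + 1)) in
      if X = Y \<or> i div 2 = X then 0 else if i div 2 = Y then b else b - 1)"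

text \<open>The first row of a block left intact. The blocks are numbered 0, 1, 2 with sum 3, so the
  third is \<open>3 - X - Y\<close>.\<close>

definition cert_block :: "nat \<Rightarrow> nat \<Rightarrow> nat" where
  "cert_block x y =
     (let X = x div 2; Y = zero_partner y div 2 in if X = Y then 2 * ((X + 1) mod 3) else 2 * (3 - X - Y))"

text \<open>Lists make the conditions executable, so the 36 pairs of a deleted row and a deleted
  column are settled by evaluation.\<close>

definition shitov_cert :: "nat \<Rightarrow> nat \<Rightarrow> nat list \<Rightarrow> nat list \<Rightarrow> bool" where
  "shitov_cert x y I J \<longleftrightarrow>
     set (map (cert_bij x y) I) = set J \<and>
     (\<forall>i\<in>set I. \<forall>j\<in>set J. cert_pot x y i - cert_pot x y (zero_partner j) \<le> shitov i j) \<and>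
     (\<forall>i\<in>set I. shitov i (cert_bij x y i) = cert_pot x y i - cert_pot x y (zero_partner (cert_bij x y i))) \<and>
     (let i = cert_block x y in i \<in> set I \<and> Suc i \<in> set I \<and>
        shitov i (cert_bij x y i) + shitov (Suc i) (cert_bij x y (Suc i))
          = shitov i (cert_bij x y (Suc i)) + shitov (Suc i) (cert_bij x y i))"

lemma shitov_cert_holds:
  "\<forall>x\<in>set [0, 1, 2, 3, 4, 5]. \<forall>y\<in>set [0, 1, 2, 3, 4, 5].
     shitov_cert x y (removeAll x [0, 1, 2, 3, 4, 5]) (removeAll y [0, 1, 2, 3, 4, 5])"
  by code_simp

lemma minors_singular_shitov_6: "minors_singular (\<lambda>i j. real_of_int (shitov i j)) {..<6} 5"
  unfolding minors_singular_def
proof (intro allI impI, elim conjE)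
  let ?A = "\<lambda>i j. real_of_int (shitov i j)"
  have six: "{..<6} = set [0, 1, 2, 3, 4, 5::nat]" using less_6_cases by auto
  have omit: "\<exists>x\<in>set [0, 1, 2, 3, 4, 5]. K = set (removeAll x [0, 1, 2, 3, 4, 5])"
    if "K \<subseteq> {..<6}" "card K = 5" for K :: "nat set"
  proof -
    have "card ({..<6} - K) = 1" using that by (subst card_Diff_subset) (auto intro: card_ge_0_finite)
    then obtain x where x: "{..<6} - K = {x}" by (auto simp: card_1_singleton_iff)
    then have "K = {..<6} - {x}" using that(1) by blast
    moreover have "x \<in> {..<6}" using x by blast
    ultimately show ?thesis unfolding six set_removeAll by blast
  qed
  fix I J :: "nat set"
  assume IJ: "I \<subseteq> {..<6}" "J \<subseteq> {..<6}" "card I = 5" "card J = 5"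
  obtain x y where xy: "x \<in> set [0, 1, 2, 3, 4, 5]" "y \<in> set [0, 1, 2, 3, 4, 5]"
    and I: "I = set (removeAll x [0, 1, 2, 3, 4, 5])" and J: "J = set (removeAll y [0, 1, 2, 3, 4, 5])"
    using omit IJ by metis
  define \<rho> where "\<rho> = cert_bij x y"
  define p where "p = cert_pot x y"
  define i where "i = cert_block x y"
  have "shitov_cert x y (removeAll x [0, 1, 2, 3, 4, 5]) (removeAll y [0, 1, 2, 3, 4, 5])"
    using shitov_cert_holds xy by blast
  then have cert: "\<rho> ` I = J" "\<And>i j. i \<in> I \<Longrightarrow> j \<in> J \<Longrightarrow> p i - p (zero_partner j) \<le> shitov i j"
    "\<And>i. i \<in> I \<Longrightarrow> shitov i (\<rho> i) = p i - p (zero_partner (\<rho> i))" "i \<in> I" "Suc i \<in> I"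
    "shitov i (\<rho> i) + shitov (Suc i) (\<rho> (Suc i)) = shitov i (\<rho> (Suc i)) + shitov (Suc i) (\<rho> i)"
    unfolding shitov_cert_def Let_def set_map I[symmetric] J[symmetric] \<rho>_def[symmetric] p_def[symmetric] i_def[symmetric]
    by blast+
  have fin: "finite I" unfolding I by simp
  have \<rho>: "bij_betw \<rho> I J"
    using cert(1) IJ fin by (simp add: bij_betw_def eq_card_imp_inj_on)
  show "sym_trop_singular ?A I J"
  proof (rule sym_trop_singular_swapI[OF \<rho> fin cert(4,5) n_not_Suc_n])
    fix \<sigma> assume \<sigma>: "bij_betw \<sigma> I J"
    show "mono_value ?A I \<rho> \<le> mono_value ?A I \<sigma>"
    proof (rule minimal_bijection_by_potentials[OF \<rho> \<sigma>,
          of "\<lambda>i. real_of_int (p i)" "\<lambda>j. - real_of_int (p (zero_partner j))"])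
      show "real_of_int (p i) + - real_of_int (p (zero_partner j)) \<le> real_of_int (shitov i j)"
        if "i \<in> I" "j \<in> J" for i j
        using cert(2)[OF that] by linarith
      show "real_of_int (shitov i (\<rho> i)) = real_of_int (p i) + - real_of_int (p (zero_partner (\<rho> i)))"
        if "i \<in> I" for i
        using cert(3)[OF that] by simp
    qed
  next
    show "real_of_int (shitov i (\<rho> i)) + real_of_int (shitov (Suc i) (\<rho> (Suc i)))
        = real_of_int (shitov i (\<rho> (Suc i))) + real_of_int (shitov (Suc i) (\<rho> i))"
      using cert(6) by linarith
  qed
qed

lemma minors_singular_shitov: "minors_singular (\<lambda>i j. real_of_int (shitov i j)) {..<6 + k} (5 + k)"
proof (induction k)
  case 0
  show ?case using minors_singular_shitov_6 by simp
next
  case (Suc k)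
  have "minors_singular (\<lambda>i j. real_of_int (shitov i j)) (insert (6 + k) {..<6 + k}) (Suc (5 + k))"
  proof (rule minors_singular_border[OF _ _ Suc.IH])
    fix i j assume "i \<in> {..<6 + k}" "j \<in> {..<6 + k}"
    then have "shitov (6 + k) (6 + k) = 0" "shitov i (6 + k) = 3" "shitov (6 + k) j = 3"
      by (auto simp: shitov_def)
    then show "real_of_int (shitov (6 + k) (6 + k)) + real_of_int (shitov i j)
        < real_of_int (shitov i (6 + k)) + real_of_int (shitov (6 + k) j)"
      using shitov_le_3[of i j] by simp
  qed simp_all
  moreover have "insert (6 + k) {..<6 + k} = {..<6 + Suc k}" by auto
  ultimately show ?case by simp
qed

text \<open>The positions where the valuations stay known exactly during the elimination; at the other
  positions the two terms of a pivot step may cancel.\<close>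

definition exact :: "nat \<Rightarrow> nat \<Rightarrow> bool" where
  "exact i j \<longleftrightarrow> i \<ge> 6 \<and> j = i \<or>
     (i, j) \<in> set [(0, 0), (2, 4), (4, 2), (1, 3), (3, 1), (1, 5), (5, 1), (3, 3), (5, 5)]"

definition lifts_shitov :: "nat set \<Rightarrow> nat set \<Rightarrow> (nat \<Rightarrow> nat \<Rightarrow> hahn) \<Rightarrow> bool" where
  "lifts_shitov S T N \<longleftrightarrow> (\<forall>i\<in>S. \<forall>j\<in>T. val_ge (N i j) (real_of_int (shitov i j)) \<and>
     (exact i j \<longrightarrow> has_val (N i j) (real_of_int (shitov i j))))"

text \<open>The pivot has valuation 0, so the first term of a step keeps the valuation of
  \<open>N i j\<close>, while the second has at least \<open>shitov i q + shitov p j\<close>. A weak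
  inequality preserves lower bounds, a strict one also exact valuations.\<close>

lemma lifts_shitov_pivot:
  assumes lift: "lifts_shitov S T N" and pq: "p \<in> S" "q \<in> T" "exact p q" "shitov p q = 0"
    and sub: "S' \<subseteq> S" "T' \<subseteq> T"
    and le: "\<forall>i\<in>S'. \<forall>j\<in>T'. shitov i j \<le> shitov i q + shitov p j \<and>
      (exact i j \<longrightarrow> shitov i j < shitov i q + shitov p j)"
  shows "lifts_shitov S' T' (pivot p q N)"
  unfolding lifts_shitov_def
proof (intro ballI conjI impI)
  fix i j assume ij: "i \<in> S'" "j \<in> T'"
  have pv: "has_val (N p q) 0" using lift pq unfolding lifts_shitov_def by force
  have v: "val_ge (N i j) (real_of_int (shitov i j))" "val_ge (N i q) (real_of_int (shitov i q))"
    "val_ge (N p j) (real_of_int (shitov p j))"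
    using lift pq sub ij unfolding lifts_shitov_def by blast+
  have 1: "val_ge (N p q * N i j) (real_of_int (shitov i j))"
    using hcoeff_times_val_ge(1)[of "N p q" 0 "N i j"] pv v(1) by (simp add: has_val_def)
  have 2: "val_ge (N i q * N p j) (real_of_int (shitov i q) + real_of_int (shitov p j))"
    by (rule hcoeff_times_val_ge(1)[OF v(2,3)])
  show "val_ge (pivot p q N i j) (real_of_int (shitov i j))"
    unfolding pivot_def using le ij by (intro val_ge_diff[OF 1] val_ge_mono[OF 2]) (metis of_int_add of_int_le_iff)
  assume ex: "exact i j"
  then have "has_val (N i j) (real_of_int (shitov i j))"
    using lift sub ij unfolding lifts_shitov_def by blast
  then have "has_val (N p q * N i j) (real_of_int (shitov i j))"
    using has_val_times[OF pv] by fastforce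
  then show "has_val (pivot p q N i j) (real_of_int (shitov i j))"
    unfolding pivot_def using le ij ex
    by (intro has_val_diff[OF _ 2]) (auto simp flip: of_int_add)
qed

lemma lifts_shitov_nonzero:
  "lifts_shitov S T N \<Longrightarrow> i \<in> S \<Longrightarrow> j \<in> T \<Longrightarrow> exact i j \<Longrightarrow> N i j \<noteq> 0"
  unfolding lifts_shitov_def using has_val_nonzero by blast

lemma shitov_6_no_lift:
  assumes lift: "lifts_shitov {..<6} {..<6} N" and van: "minors_vanish {..<6} {..<6} N 5"
  shows False
proof -
  \<comment> \<open>Each pivot drops its row and column. The pivots at (2, 4) and (4, 2) lie off the
    diagonal, so rows and columns differ in between, but 1, 3, 5 survive on both sides.\<close>
  let ?S1 = "set [1, 2, 3, 4, 5::nat]" and ?S2 = "set [1, 3, 4, 5::nat]" and ?T2 = "set [1, 2, 3, 5::nat]"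
    and ?S3 = "set [1, 3, 5::nat]"
  define N1 where "N1 = pivot 0 0 N"
  define N2 where "N2 = pivot 2 4 N1"
  define N3 where "N3 = pivot 4 2 N2"
  have ex: "exact 0 0" "exact 2 4" "exact 4 2" by (simp_all add: exact_def)
  have zero: "shitov 0 0 = 0" "shitov 2 4 = 0" "shitov 4 2 = 0" by (simp_all add: shitov_def)
  have l1: "lifts_shitov ?S1 ?S1 N1"
    unfolding N1_def
  proof (rule lifts_shitov_pivot[OF lift _ _ ex(1) zero(1)])
    show "\<forall>i\<in>?S1. \<forall>j\<in>?S1. shitov i j \<le> shitov i 0 + shitov 0 j \<and>
        (exact i j \<longrightarrow> shitov i j < shitov i 0 + shitov 0 j)" by code_simp
  qed auto
  have l2: "lifts_shitov ?S2 ?T2 N2"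
    unfolding N2_def
  proof (rule lifts_shitov_pivot[OF l1 _ _ ex(2) zero(2)])
    show "\<forall>i\<in>?S2. \<forall>j\<in>?T2. shitov i j \<le> shitov i 4 + shitov 2 j \<and>
        (exact i j \<longrightarrow> shitov i j < shitov i 4 + shitov 2 j)" by code_simp
  qed auto
  have l3: "lifts_shitov ?S3 ?S3 N3"
    unfolding N3_def
  proof (rule lifts_shitov_pivot[OF l2 _ _ ex(3) zero(3)])
    show "\<forall>i\<in>?S3. \<forall>j\<in>?S3. shitov i j \<le> shitov i 2 + shitov 4 j \<and>
        (exact i j \<longrightarrow> shitov i j < shitov i 2 + shitov 4 j)" by code_simp
  qed auto
  have "minors_vanish {..<6} {..<6} N (Suc 4)" using van by simp
  then have "minors_vanish {..<6} {..<6} N1 4"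
    unfolding N1_def by (rule minors_vanish_pivot) (use lifts_shitov_nonzero[OF lift _ _ ex(1)] in auto)
  then have "minors_vanish {..<6} {..<6} N1 (Suc 3)" by simp
  then have "minors_vanish {..<6} {..<6} N2 3"
    unfolding N2_def by (rule minors_vanish_pivot) (use lifts_shitov_nonzero[OF l1 _ _ ex(2)] in auto)
  then have "minors_vanish {..<6} {..<6} N2 (Suc 2)" by simp
  then have "minors_vanish {..<6} {..<6} N3 2"
    unfolding N3_def by (rule minors_vanish_pivot) (use lifts_shitov_nonzero[OF l2 _ _ ex(3)] in auto)
  then have rk: "N3 i j * N3 i' j' = N3 i j' * N3 i' j" if "i < 6" "i' < 6" "j < 6" "j' < 6" for i j i' j'
    using that by (intro minors_vanish_2D) auto
  \<comment> \<open>Both products are compared through the diagonal one. Cancellation may have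
    raised the valuation of its factor \<open>N3 1 1\<close>, so only the equations are
    used.\<close>
  have "N3 1 5 * N3 5 1 * N3 3 3 = N3 1 1 * N3 5 5 * N3 3 3"
    using rk[of 1 5 1 5] by simp
  also have "\<dots> = N3 1 1 * N3 3 3 * N3 5 5" by (simp only: mult.commute mult.left_commute)
  also have "\<dots> = N3 1 3 * N3 3 1 * N3 5 5"
    using rk[of 1 3 1 3] by simp
  finally have eq: "N3 1 5 * N3 5 1 * N3 3 3 = N3 1 3 * N3 3 1 * N3 5 5" .
  have "has_val (N3 i j) (real_of_int (shitov i j))" if "i \<in> ?S3" "j \<in> ?S3" "exact i j" for i j
    using l3 that unfolding lifts_shitov_def by blast
  \<comment> \<open>The entry 2 at (5, 5), against 1 at (3, 3), separates the two products.\<close>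
  then have v: "has_val (N3 1 5) 1" "has_val (N3 5 1) 1" "has_val (N3 3 3) 1"
    "has_val (N3 1 3) 1" "has_val (N3 3 1) 1" "has_val (N3 5 5) 2"
    by (force simp: exact_def shitov_def)+
  have "has_val (N3 1 5 * N3 5 1 * N3 3 3) (1 + 1 + 1)" "has_val (N3 1 3 * N3 3 1 * N3 5 5) (1 + 1 + 2)"
    by (intro has_val_times v)+
  then show False unfolding eq using has_val_unique by fastforce
qed

text \<open>The border entries off the diagonal are 3, so a pivot at the zero in the corner
  subtracts a term of valuation at least 6, above every entry of the matrix.\<close>

lemma shitov_no_lift:
  "lifts_shitov {..<6 + k} {..<6 + k} N \<Longrightarrow> minors_vanish {..<6 + k} {..<6 + k} N (5 + k) \<Longrightarrow> False"
proof (induction k arbitrary: N)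
  case 0
  then show ?case using shitov_6_no_lift by simp
next
  case (Suc k)
  let ?p = "6 + k"
  have p: "?p \<in> {..<6 + Suc k}" "exact ?p ?p" "shitov ?p ?p = 0"
    by (simp_all add: exact_def shitov_def)
  have "lifts_shitov {..<6 + k} {..<6 + k} (pivot ?p ?p N)"
  proof (rule lifts_shitov_pivot[OF Suc.prems(1) p(1,1,2,3)])
    have "shitov i ?p = 3" "shitov ?p i = 3" if "i < 6 + k" for i
      using that by (auto simp: shitov_def)
    moreover have "shitov i j < 6" for i j using shitov_le_3[of i j] by simp
    ultimately show "\<forall>i\<in>{..<6 + k}. \<forall>j\<in>{..<6 + k}. shitov i j \<le> shitov i ?p + shitov ?p j \<and>
        (exact i j \<longrightarrow> shitov i j < shitov i ?p + shitov ?p j)" by (auto intro: less_imp_le)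
  qed auto
  moreover have "minors_vanish {..<6 + Suc k} {..<6 + Suc k} (pivot ?p ?p N) (5 + k)"
    using Suc.prems lifts_shitov_nonzero[OF Suc.prems(1) p(1,1,2)] p by (intro minors_vanish_pivot) simp_all
  then have "minors_vanish {..<6 + k} {..<6 + k} (pivot ?p ?p N) (5 + k)"
    by (rule minors_vanish_mono) auto
  ultimately show ?case by (rule Suc.IH)
qed

lemma not_tropical_basis_ge_5:
  assumes "4 < r" "r < n"
  shows "\<not> sym_minors_tropical_basis n r"
proof
  assume basis: "sym_minors_tropical_basis n r"
  define k where "k = r - 5"
  have r: "r = 5 + k" using assms(1) by (simp add: k_def)
  \<comment> \<open>Indices beyond \<open>r\<close> copy row and column 0; the first
    \<open>r + 1 = 6 + k\<close> indices carry the matrix bordered \<open>k\<close> times.\<close>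
  define \<phi> where "\<phi> i = (if i \<le> r then i else 0)" for i
  define A where "A i j = real_of_int (shitov (\<phi> i) (\<phi> j))" for i j
  have "\<phi> ` {..<n} = {..<6 + k}"
  proof
    show "\<phi> ` {..<n} \<subseteq> {..<6 + k}" by (auto simp: \<phi>_def r)
    show "{..<6 + k} \<subseteq> \<phi> ` {..<n}"
    proof
      fix i assume "i \<in> {..<6 + k}"
      then have "\<phi> i = i" "i \<in> {..<n}" using assms(2) by (auto simp: \<phi>_def r)
      then show "i \<in> \<phi> ` {..<n}" by (metis imageI)
    qed
  qed
  then have "minors_singular A {..<n} r"
    using minors_singular_duplicate[of "{..<n}" "\<lambda>i j. real_of_int (shitov i j)" \<phi> r] minors_singular_shitov[of k]
    by (simp add: A_def[abs_def] r)
  then have "\<forall>I J. I \<subseteq> {..<n} \<and> J \<subseteq> {..<n} \<and> card I = r \<and> card J = r \<longrightarrow> sym_trop_singular A I J"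
    unfolding minors_singular_def .
  moreover have "sym_real_mat n A"
    by (simp add: sym_real_mat_def A_def shitov_sym)
  ultimately obtain M where lift: "symmetric_lift n A M" and rank: "hahn_rank_lt n M r"
    using basis unfolding sym_minors_tropical_basis_def by blast
  define N where "N i j = Abs_hahn (M i j)" for i j
  have hahn: "is_hahn (M i j)" and val: "has_val (N i j) (A i j)" if "i < n" "j < n" for i j
    using lift that has_val_hahn_deg[of "M i j"] unfolding symmetric_lift_def N_def by metis+
  have "lifts_shitov {..<6 + k} {..<6 + k} N"
    unfolding lifts_shitov_def
  proof (intro ballI)
    fix i j assume "i \<in> {..<6 + k}" "j \<in> {..<6 + k}"
    then have "i < n" "j < n" "A i j = real_of_int (shitov i j)" using assms(2) by (auto simp: A_def \<phi>_def r)
    then show "val_ge (N i j) (real_of_int (shitov i j)) \<and>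
        (exact i j \<longrightarrow> has_val (N i j) (real_of_int (shitov i j)))"
      using val[of i j] by (simp add: has_val_def)
  qed
  moreover have "minors_vanish {..<6 + k} {..<6 + k} N (5 + k)"
    unfolding minors_vanish_def
  proof (intro allI impI)
    fix u v :: "nat \<Rightarrow> nat" assume uv: "\<forall>l<5 + k. u l \<in> {..<6 + k} \<and> v l \<in> {..<6 + k}"
    then have lt: "u l < n \<and> v l < n" if "l < r" for l using that assms(2) by (fastforce simp: r)
    then have "hahn_minor M r u v g = 0" for g using rank unfolding hahn_rank_lt_def by blast
    then have "hcoeff (det (mat r r (\<lambda>(i, j). N (u i) (v j)))) g = 0" for g
      using hahn_minor_eq_det[of r M u v g] lt hahn by (simp add: N_def)
    then show "det (mat (5 + k) (5 + k) (\<lambda>(i, j). N (u i) (v j))) = 0"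
      unfolding r[symmetric] by (intro hahn_eqI) simp
  qed
  ultimately show False by (rule shitov_no_lift)
qed

theorem theorem7:
  fixes n r :: nat
  assumes "(4 < r \<and> r < n) \<or> (r = 4 \<and> 12 < n)"
  shows "\<not> sym_minors_tropical_basis n r"
  using assms not_tropical_basis_ge_5 not_tropical_basis_4 by blast

end
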